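(* Let $K\subseteq\mathbb{R}^n$ be a nonempty closed convex set, and let $\mu\in\mathbb{R}^n$ be arbitrary (not necessarily in $K$). Let $Z$ be an $n$-dimensional standard Gaussian random vector, and let $\hat\mu:=P_K(Z+\mu)$. For $t\ge 0$ let $$f_\mu(t):=\mathbb{E}\Bigl(\sup_{\nu\in K:\ \|\nu-\mu\|\le t} Z\cdot(\nu-\mu)\Bigr)-\frac{t^2}{2},$$ and let $t_c:=\inf_{\nu\in K}\|\nu-\mu\|$. Then $f_\mu(t)$ is equal to $-\infty$ when $t<t_c$, is a finite and strictly concave function of $t$ when $t\in[t_c,\infty)$, and decays to $-\infty$ as $t\to\infty$. Consequently, the point $t_\mu\in[0,\infty)$ at which $f_\mu$ attains its maximum exists and is unique. Moreover, for any $x\ge 0$, $$\mathbb{P}\Bigl(\bigl|\,\|\hat\mu-\mu\|-t_\mu\bigr|\ge x\sqrt{t_\mu}\Bigr)\le 3\exp\left(-\frac{x^4}{32\bigl(1+x/\sqrt{t_\mu}\bigr)^2}\right).$$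
   Context: $\|\cdot\|$ is the Euclidean norm and $x\cdot y$ the usual inner product on $\mathbb{R}^n$. For a nonempty closed convex set $K\subseteq\mathbb{R}^n$, $P_K(x)$ denotes the unique point of $K$ closest to $x$ in Euclidean distance. The supremum of an empty set is $-\infty$, so $f_\mu(t)=-\infty$ when no $\nu\in K$ satisfies $\|\nu-\mu\|\le t$. *)

theory Defs
  imports "HOL-Probability.Probability"
begin

definition std_gaussian_vector :: "'s measure \<Rightarrow> ('s \<Rightarrow> real ^ 'n) \<Rightarrow> bool" where
  "std_gaussian_vector M Z \<longleftrightarrow>
     distributed M lborel Z (\<lambda>z. ennreal (\<Prod>i\<in>UNIV. std_normal_density (z $ i)))"

(* The library's Bochner integral is only for Banach-space-valued functions.  For extended-real
   random variables this is E X = E X^+ - E X^-, since e2ennreal sends negative values to 0.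
   If both parts are infinite, the value is the ereal convention \<infinity> - \<infinity> = \<infinity>. *)
definition ereal_expectation :: "'s measure \<Rightarrow> ('s \<Rightarrow> ereal) \<Rightarrow> ereal" where
  "ereal_expectation M X =
     enn2ereal (\<integral>\<^sup>+ \<omega>. e2ennreal (X \<omega>) \<partial>M) - enn2ereal (\<integral>\<^sup>+ \<omega>. e2ennreal (- X \<omega>) \<partial>M)"

(* f_mu(t).  The supremum is taken in ereal, where SUP over the empty set is -\<infinity>. *)
definition lse_fun ::
    "'s measure \<Rightarrow> ('s \<Rightarrow> real ^ 'n) \<Rightarrow> (real ^ 'n) set \<Rightarrow> real ^ 'n \<Rightarrow> real \<Rightarrow> ereal" where
  "lse_fun M Z K \<mu> t =
     ereal_expectation M
       (\<lambda>\<omega>. SUP \<nu>\<in>{\<nu> \<in> K. norm (\<nu> - \<mu>) \<le> t}. ereal (Z \<omega> \<bullet> (\<nu> - \<mu>)))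
     - ereal (t\<^sup>2 / 2)"

definition t_crit :: "(real ^ 'n) set \<Rightarrow> real ^ 'n \<Rightarrow> real" where
  "t_crit K \<mu> = (INF \<nu>\<in>K. norm (\<nu> - \<mu>))"

(* A maximizer of f_mu on [0, \<infinity>); arg_max is a choice operator, so this is the t_mu of the text
   only in view of the existence and uniqueness of the maximizer. *)
definition t_max ::
    "'s measure \<Rightarrow> ('s \<Rightarrow> real ^ 'n) \<Rightarrow> (real ^ 'n) set \<Rightarrow> real ^ 'n \<Rightarrow> real" where
  "t_max M Z K \<mu> = arg_max (lse_fun M Z K \<mu>) (\<lambda>t. 0 \<le> t)"

definition strictly_concave_on :: "real set \<Rightarrow> (real \<Rightarrow> real) \<Rightarrow> bool" where
  "strictly_concave_on S f \<longleftrightarrow> convex S \<and>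
     (\<forall>x\<in>S. \<forall>y\<in>S. \<forall>u. x \<noteq> y \<and> 0 < u \<and> u < 1 \<longrightarrow>
        (1 - u) * f x + u * f y < f ((1 - u) * x + u * y))"

(* x^4 / (32 (1 + x / sqrt t)^2), for x, t \<ge> 0.  At t = 0 the quotient x / sqrt t is read as
   infinite, so the exponent is 0; HOL's x / 0 = 0 would give x^4 / 32 instead. *)
definition tail_exponent :: "real \<Rightarrow> real \<Rightarrow> real" where
  "tail_exponent x t = (if t = 0 then 0 else x ^ 4 / (32 * (1 + x / sqrt t)\<^sup>2))"

end

theory Submission
  imports Defs
begin

text \<open>
  Write $m_t(z) = \sup \{z \cdot (\nu - \mu) : \nu \in K, \|\nu - \mu\| \le t\}$.  The distance
  $r = \|\hat\mu - \mu\|$ of the least squares estimate is the maximizer of the random function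
  $t \mapsto m_t(Z) - t^2/2$, because minimizing $\|Z + \mu - \nu\|^2$ over $K$ is the same as
  maximizing $Z \cdot (\nu - \mu) - \|\nu - \mu\|^2/2$.  Convexity of $K$ makes $m_t(z)$ concave
  in $t$, so the random function and its expectation $f$ are both strongly concave: $f$ has a unique
  maximizer $T$, and $f(t) \le f(T) - (t - T)^2/2$.  If $r$ is at distance at least
  $x \sqrt T$ from $T$, then concavity forces the random function to be at least as large at
  $T + x \sqrt T$ or at $T - x \sqrt T$ as at $T$, although its mean there is smaller by
  $x^2 T/2$.  Hence one of three variables $m_t(Z)$ deviates from its mean by $x^2 T/4$; as $m_t$ is
  $t$-Lipschitz, Gaussian concentration bounds the probability of each such deviation.  Right
  continuity of $f$ at the critical radius, which existence of the maximizer needs, comes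
  from the obtuse angle property of the projection of $\mu$ onto $K$
  (\<open>slice_support_hoelder\<close>).

  The constant 32 requires Gaussian concentration with its optimal exponent
  (\<open>gaussian_lipschitz_concentration\<close>).  It follows from an infimum-convolution
  inequality that is dual to Talagrand's transport inequality: if
  $G(x) \le F(y) + |x - y|^2/2$ for all $x, y$, then
  $\int e^G d\gamma \le \exp \int F d\gamma$ for the standard Gaussian measure $\gamma$
  (\<open>product_gaussian_exp_transport_bound\<close>).  For a function $f$ with Lipschitz constant $L$,
  the pair $F = \lambda f$ and $G = \lambda f - \lambda^2 L^2/2$ satisfies the hypothesis, which gives the
  optimal moment generating function.  The inequality passes from each factor to a product, so
  only the line needs an argument: there, transport $\gamma$ monotonically to the measure with density
  proportional to $e^G$, take the logarithm of the change of variables formula, and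
  integrate by parts.
\<close>

section \<open>Monotone transport on an interval\<close>

text \<open>
  The map is $T = Q^{-1} \circ P$, for the distribution functions $P$ and $Q$ of the two densities; its
  derivative is the one-dimensional change of variables formula $p = (q \circ T) \, T'$.
\<close>

lemma monotone_transport_on_interval:
  fixes p q :: "real \<Rightarrow> real"
  assumes ab: "a < b"
    and cp: "continuous_on {a..b} p" and cq: "continuous_on {a..b} q"
    and pp: "\<And>x. x \<in> {a..b} \<Longrightarrow> 0 < p x" and qp: "\<And>x. x \<in> {a..b} \<Longrightarrow> 0 < q x"
    and mass: "integral {a..b} p = integral {a..b} q"
  obtains T where "continuous_on {a..b} T" "T ` {a..b} \<subseteq> {a..b}" "T a = a" "T b = b"
    "\<And>x. x \<in> {a<..<b} \<Longrightarrow> (T has_real_derivative p x / q (T x)) (at x)"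
proof -
  define P where "P = (\<lambda>x. integral {a..x} p)"
  define Q where "Q = (\<lambda>x. integral {a..x} q)"
  have deriv_int: "((\<lambda>x. integral {a..x} r) has_real_derivative r x) (at x)"
    if "continuous_on {a..b} r" "x \<in> {a<..<b}" for r :: "real \<Rightarrow> real" and x
    using integral_has_real_derivative[OF that(1), of x] that(2)
    by (metis at_within_Icc_at greaterThanLessThan_iff atLeastAtMost_iff less_imp_le)
  have cont_int: "continuous_on {a..b} (\<lambda>x. integral {a..x} r)"
    if "continuous_on {a..b} r" for r :: "real \<Rightarrow> real"
    using that by (intro indefinite_integral_continuous_1 integrable_continuous_real)
  have strict: "integral {a..x} r < integral {a..y} r"
    if "continuous_on {a..b} r" "\<And>x. x \<in> {a..b} \<Longrightarrow> 0 < r x" "a \<le> x" "x < y" "y \<le> b"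
    for r :: "real \<Rightarrow> real" and x y
  proof (rule DERIV_pos_imp_increasing_open[OF \<open>x < y\<close>])
    fix z assume "x < z" "z < y"
    then show "\<exists>d. ((\<lambda>x. integral {a..x} r) has_real_derivative d) (at z) \<and> 0 < d"
      using deriv_int[OF that(1), of z] that by (intro exI[of _ "r z"]) auto
  qed (use cont_int[OF that(1)] that in \<open>auto intro: continuous_on_subset\<close>)
  have cP: "continuous_on {a..b} P" and cQ: "continuous_on {a..b} Q"
    unfolding P_def Q_def using cp cq by (auto intro: cont_int)
  have mP: "P x < P y" if "a \<le> x" "x < y" "y \<le> b" for x y
    unfolding P_def using strict[OF cp pp] that by blast
  have mQ: "Q x < Q y" if "a \<le> x" "x < y" "y \<le> b" for x y
    unfolding Q_def using strict[OF cq qp] that by blast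
  have ends: "P a = 0" "Q a = 0" "P b = Q b"
    using mass by (auto simp: P_def Q_def)
  have inj: "inj_on Q {a..b}"
    by (rule linorder_inj_onI') (use mQ in \<open>force\<close>)
  have img: "Q ` {a..b} = {0..Q b}"
  proof
    show "Q ` {a..b} \<subseteq> {0..Q b}"
      using mQ ends by (force simp: le_less)
    show "{0..Q b} \<subseteq> Q ` {a..b}"
    proof
      fix y assume "y \<in> {0..Q b}"
      then show "y \<in> Q ` {a..b}"
        using IVT'[of Q a y b] ends cQ ab by force
    qed
  qed
  define H where "H = inv_into {a..b} Q"
  have HQ: "H (Q x) = x" if "x \<in> {a..b}" for x
    unfolding H_def using inj that by (rule inv_into_f_f)
  have QH: "Q (H y) = y" and Hin: "H y \<in> {a..b}" if "y \<in> {0..Q b}" for y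
    using that img f_inv_into_f[of y Q "{a..b}"] inv_into_into[of y Q "{a..b}"] by (auto simp: H_def)
  have cH: "continuous_on {0..Q b} H"
    using continuous_on_inv[OF cQ compact_Icc, of H] HQ img by auto
  have Pin: "P x \<in> {0..Q b}" if "x \<in> {a..b}" for x
    using mP[of a x] mP[of x b] that ends by (force simp: le_less)
  define T where "T = (\<lambda>x. H (P x))"
  show ?thesis
  proof
    show "continuous_on {a..b} T"
      unfolding T_def by (rule continuous_on_compose2[OF cH cP]) (use Pin in auto)
    show "T ` {a..b} \<subseteq> {a..b}"
      using Pin Hin by (auto simp: T_def)
    show "T a = a" "T b = b"
      using HQ[of a] HQ[of b] ends ab by (auto simp: T_def)
    fix x assume x: "x \<in> {a<..<b}"
    have Px: "0 < P x" "P x < Q b"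
      using mP[of a x] mP[of x b] x ends by auto
    have "H (P x) \<noteq> a" "H (P x) \<noteq> b"
      using QH[of "P x"] Px ends by auto
    then have Hx: "H (P x) \<in> {a<..<b}"
      using Hin[of "P x"] Px by auto
    have "(H has_real_derivative inverse (q (H (P x)))) (at (P x))"
    proof (rule DERIV_inverse_function[OF _ _ Px])
      show "(Q has_real_derivative q (H (P x))) (at (H (P x)))"
        unfolding Q_def by (rule deriv_int[OF cq Hx])
      show "q (H (P x)) \<noteq> 0" using qp[of "H (P x)"] Hx by auto
      show "Q (H y) = y" if "0 < y" "y < Q b" for y using QH that by auto
      show "isCont H (P x)"
        using cH Px by (intro continuous_on_interior[OF cH]) auto
    qed
    moreover have "(P has_real_derivative p x) (at x)"
      unfolding P_def by (rule deriv_int[OF cp x])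
    ultimately have "((\<lambda>x. H (P x)) has_real_derivative inverse (q (H (P x))) * p x) (at x)"
      by (rule DERIV_chain2)
    then show "(T has_real_derivative p x / q (T x)) (at x)"
      unfolding T_def by (simp add: divide_inverse mult.commute)
  qed
qed

section \<open>An exponential inequality for the Gaussian measure on the line\<close>

lemma DERIV_std_normal_density:
  "(std_normal_density has_real_derivative - x * std_normal_density x) (at x)"
proof -
  have "((\<lambda>x. exp (- x\<^sup>2 / 2)) has_real_derivative exp (- x\<^sup>2 / 2) * - x) (at x)"
    by (auto intro!: derivative_eq_intros)
  from DERIV_cmult[OF this, of "1 / sqrt (2 * pi)"] show ?thesis
    by (simp add: std_normal_density_def[abs_def] mult_ac)
qed

lemma continuous_on_std_normal_density [continuous_intros]:
  "continuous_on S std_normal_density"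
  using DERIV_std_normal_density by (meson DERIV_isCont continuous_at_imp_continuous_on)

text \<open>
  Let $w$ be the Gaussian density and $T$ the transport from $w$ to $q = (A/B) \, e^g w$ on the interval.
  The logarithm of $w = (q \circ T) \, T'$ expresses $\ln (B/A)$ through $T$; the hypothesis on
  $f$ and $g$ at the points $T x$ and $x$, together with $\ln T' \le T' - 1$, bounds it by
  $f(x) + (T'(x) - 1) - x (T x - x)$.  Multiplied by $w$, the part after $f(x)$ is the derivative of
  $(T x - x) \, w(x)$, which vanishes at both ends of the interval.  This cancellation is the
  reason for working on a bounded interval: no estimate on the growth of $T$ is required.
\<close>

lemma gaussian_transport_interval:
  fixes f g :: "real \<Rightarrow> real"
  assumes cf: "continuous_on UNIV f" and cg: "continuous_on UNIV g"
    and le: "\<And>x y. g x \<le> f y + (x - y)\<^sup>2 / 2" and a: "0 < a"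
  defines "A \<equiv> integral {-a..a} std_normal_density"
    and "B \<equiv> integral {-a..a} (\<lambda>x. exp (g x) * std_normal_density x)"
  shows "0 < A" "0 < B" "A * ln (B / A) \<le> integral {-a..a} (\<lambda>x. f x * std_normal_density x)"
proof -
  let ?w = "std_normal_density" and ?I = "{-a..a}"
  have cw: "continuous_on S ?w" for S by (rule continuous_on_std_normal_density)
  have cf': "continuous_on S f" and cg': "continuous_on S g" for S
    using cf cg by (auto intro: continuous_on_subset)
  have pos: "0 < integral ?I r" if "continuous_on ?I r" "\<And>x. 0 < r x" for r :: "real \<Rightarrow> real"
  proof -
    have "0 \<le> integral ?I r" using that by (intro integral_nonneg integrable_continuous_real) (auto intro: less_imp_le)
    moreover have "integral ?I r \<noteq> 0"
      using integral_eq_0_iff[OF that(1)] that(2)[of 0] a that(2) by (force simp: less_imp_le)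
    ultimately show ?thesis by simp
  qed
  show A: "0 < A" unfolding A_def by (rule pos) (auto intro: cw normal_density_pos)
  show B: "0 < B" unfolding B_def
    by (rule pos) (auto intro!: continuous_intros cw cg' mult_pos_pos normal_density_pos)
  define q where "q = (\<lambda>x. A / B * (exp (g x) * ?w x))"
  have q: "0 < q x" for x using A B by (simp add: q_def normal_density_pos)
  have cq: "continuous_on S q" for S
    unfolding q_def using B by (auto intro!: continuous_intros cw cg')
  have "integral ?I q = A / B * B" unfolding q_def B_def by simp
  then have mass: "integral ?I ?w = integral ?I q" using B by (simp add: A_def)
  obtain T where T: "continuous_on ?I T" "T ` ?I \<subseteq> ?I" "T (-a) = -a" "T a = a"
    and dT: "\<And>x. x \<in> {-a<..<a} \<Longrightarrow> (T has_real_derivative ?w x / q (T x)) (at x)"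
    by (rule monotone_transport_on_interval[OF _ cw cq _ _ mass]) (use a q in \<open>auto simp: normal_density_pos\<close>)
  \<comment> \<open>\<open>D\<close> is the derivative of \<open>(T x - x) * w x\<close>, since \<open>w' x = - x * w x\<close>.\<close>
  define D where "D = (\<lambda>x. (?w x / q (T x) - 1) * ?w x - x * (T x - x) * ?w x)"
  have "(D has_integral (T a - a) * ?w a - (T (-a) - (-a)) * ?w (-a)) ?I"
  proof (rule fundamental_theorem_of_calculus_interior)
    fix x assume x: "x \<in> {-a<..<a}"
    show "((\<lambda>x. (T x - x) * ?w x) has_vector_derivative D x) (at x)"
      unfolding has_real_derivative_iff_has_vector_derivative[symmetric] D_def
      by (rule derivative_eq_intros dT[OF x] DERIV_std_normal_density refl)+ (use q[of "T x"] in \<open>simp add: algebra_simps\<close>)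
  qed (use a in \<open>auto intro!: continuous_intros cw T\<close>)
  then have D: "(D has_integral 0) ?I" using T by simp
  have "(\<lambda>x. f x * ?w x) integrable_on ?I"
    by (intro integrable_continuous_real continuous_intros cw cf')
  from has_integral_add[OF integrable_integral[OF this] D]
  have R: "((\<lambda>x. f x * ?w x + D x) has_integral integral ?I (\<lambda>x. f x * ?w x)) ?I" by simp
  have "?w integrable_on ?I" by (intro integrable_continuous_real cw)
  from has_integral_mult_left[OF integrable_integral[OF this], of "ln (B / A)"]
  have L: "((\<lambda>x. ?w x * ln (B / A)) has_integral A * ln (B / A)) ?I" by (simp add: A_def)
  show "A * ln (B / A) \<le> integral ?I (\<lambda>x. f x * ?w x)"
  proof (rule has_integral_le[OF L R])
    fix x
    let ?r = "?w x / q (T x)"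
    have wx: "0 < ?w x" "0 < ?w (T x)" by (auto simp: normal_density_pos)
    have "?r > 0" using wx q by simp
    have "ln ?r \<le> ?r - 1" using \<open>?r > 0\<close> by (rule ln_le_minus_one)
    moreover have "ln ?r = ln (?w x) - ln (q (T x))" using wx q[of "T x"] by (simp add: ln_div)
    moreover have "ln (q (T x)) = - ln (B / A) + g (T x) + ln (?w (T x))"
      using A B wx by (simp add: q_def ln_mult ln_div)
    moreover have "ln (?w y) = - ln (sqrt (2 * pi)) - y\<^sup>2 / 2" for y
      unfolding std_normal_density_def by (subst ln_mult) (auto simp: ln_div)
    ultimately have "ln (B / A) \<le> ?r - 1 + x\<^sup>2 / 2 - (T x)\<^sup>2 / 2 + g (T x)" by simp
    also have "g (T x) \<le> f x + (T x - x)\<^sup>2 / 2" by (rule le)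
    finally have "ln (B / A) \<le> ?r - 1 + x\<^sup>2 / 2 - (T x)\<^sup>2 / 2 + (f x + (T x - x)\<^sup>2 / 2)" by simp
    also have "\<dots> = f x + (?r - 1) - x * (T x - x)"
      by (simp only: power2_eq_square) (simp add: algebra_simps add_divide_distrib diff_divide_distrib)
    finally have "ln (B / A) \<le> f x + (?r - 1) - x * (T x - x)" .
    from mult_right_mono[OF this, of "?w x"] wx
    show "?w x * ln (B / A) \<le> f x * ?w x + D x" by (simp add: D_def algebra_simps)
  qed
qed

abbreviation std_gaussian :: "real measure" where
  "std_gaussian \<equiv> density lborel (\<lambda>x. ennreal (std_normal_density x))"

lemma truncated_integral_tendsto:
  fixes h :: "real \<Rightarrow> real"
  assumes "continuous_on UNIV h" "integrable lborel h"
  shows "(\<lambda>n. integral {- real (Suc n)..real (Suc n)} h) \<longlonglongrightarrow> (\<integral>x. h x \<partial>lborel)"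
proof -
  have ch: "continuous_on S h" for S
    using assms(1) by (rule continuous_on_subset) simp
  let ?J = "\<lambda>n. {- real (Suc n)..real (Suc n)}"
  have "integral (?J n) h = (\<integral>x. indicator (?J n) x * h x \<partial>lborel)" for n
    using set_borel_integral_eq_integral(2)[OF borel_integrable_atLeastAtMost'[OF ch]]
    by (simp add: set_lebesgue_integral_def)
  moreover have "(\<lambda>n. \<integral>x. indicator (?J n) x * h x \<partial>lborel) \<longlonglongrightarrow> (\<integral>x. h x \<partial>lborel)"
  proof (rule integral_dominated_convergence[where w="\<lambda>x. \<bar>h x\<bar>"])
    show "AE x in lborel. (\<lambda>n. indicator (?J n) x * h x) \<longlonglongrightarrow> h x"
    proof (rule AE_I2)
      fix x :: real
      obtain N :: nat where N: "\<bar>x\<bar> \<le> real N" using real_arch_simple by blast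
      have "eventually (\<lambda>n. indicator (?J n) x * h x = h x) sequentially"
        using eventually_ge_at_top[of N] by eventually_elim (use N in \<open>auto simp: indicator_def\<close>)
      then show "(\<lambda>n. indicator (?J n) x * h x) \<longlonglongrightarrow> h x" by (rule tendsto_eventually)
    qed
  qed (use assms in \<open>auto simp: indicator_def\<close>)
  ultimately show ?thesis by simp
qed

text \<open>
  This is the limit of the bound on $[-n, n]$: solved for $B$, it reads
  $B \le A \exp (I/A)$, where $A$, $B$ and $I$ are the truncations of the total mass $1$ and of the two
  integrals in the claim.
\<close>

lemma gaussian_exp_transport_bound:
  fixes f g :: "real \<Rightarrow> real"
  assumes cf: "continuous_on UNIV f" and cg: "continuous_on UNIV g"
    and le: "\<And>x y. g x \<le> f y + (x - y)\<^sup>2 / 2"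
    and int: "integrable std_gaussian f"
  shows "(\<integral>\<^sup>+x. ennreal (exp (g x)) \<partial>std_gaussian) \<le> ennreal (exp (\<integral>x. f x \<partial>std_gaussian))"
proof -
  let ?w = "std_normal_density"
  let ?J = "\<lambda>n. {- real (Suc n)..real (Suc n)}"
  define A where "A = (\<lambda>n. integral (?J n) ?w)"
  define B where "B = (\<lambda>n. integral (?J n) (\<lambda>x. exp (g x) * ?w x))"
  define I where "I = (\<lambda>n. integral (?J n) (\<lambda>x. f x * ?w x))"
  have mg [measurable]: "g \<in> borel_measurable borel" and mf [measurable]: "f \<in> borel_measurable borel"
    using cg cf by (auto intro: borel_measurable_continuous_onI)
  have cB: "continuous_on S (\<lambda>x. exp (g x) * ?w x)" for S
    by (intro continuous_intros continuous_on_subset[OF cg]) simp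
  have int': "integrable lborel (\<lambda>x. f x * ?w x)"
    using int by (subst (asm) integrable_density) (auto simp: mult.commute)
  have If: "(\<integral>x. f x \<partial>std_gaussian) = (\<integral>x. f x * ?w x \<partial>lborel)"
    by (subst integral_density) (auto simp: mult.commute)
  note step = gaussian_transport_interval[OF cf cg le, of "real (Suc n)" for n]
  have A0: "0 < A n" and B0: "0 < B n" and AB: "A n * ln (B n / A n) \<le> I n" for n
    using step[of n] by (auto simp: A_def B_def I_def)
  have Bn: "B n \<le> A n * exp (I n / A n)" for n
  proof -
    have "ln (B n / A n) \<le> I n / A n"
      using AB[of n] A0[of n] by (simp add: field_simps)
    then have "B n / A n \<le> exp (I n / A n)"
      using A0[of n] B0[of n] by (metis divide_pos_pos exp_le_cancel_iff exp_ln)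
    then show ?thesis using A0[of n] by (simp add: field_simps)
  qed
  have "A \<longlonglongrightarrow> 1"
    using truncated_integral_tendsto[of ?w] unfolding A_def
    by (simp add: continuous_on_std_normal_density)
  moreover have "I \<longlonglongrightarrow> (\<integral>x. f x \<partial>std_gaussian)"
    unfolding If I_def
    by (intro truncated_integral_tendsto int' continuous_intros cf)
  ultimately have "(\<lambda>n. A n * exp (I n / A n)) \<longlonglongrightarrow> 1 * exp ((\<integral>x. f x \<partial>std_gaussian) / 1)"
    by (intro tendsto_intros) auto
  then have R: "(\<lambda>n. ennreal (A n * exp (I n / A n))) \<longlonglongrightarrow> ennreal (exp (\<integral>x. f x \<partial>std_gaussian))"
    by (intro tendsto_ennrealI) simp
  let ?h = "\<lambda>n x. ennreal (indicator (?J n) x * (exp (g x) * ?w x))"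
  have "(\<lambda>n. integral\<^sup>N lborel (?h n)) \<longlonglongrightarrow> (\<integral>\<^sup>+x. ennreal (exp (g x) * ?w x) \<partial>lborel)"
  proof (rule nn_integral_LIMSEQ)
    show "incseq ?h"
      by (auto simp: incseq_def le_fun_def indicator_def intro!: ennreal_leI)
    show "(\<lambda>n. ?h n x) \<longlonglongrightarrow> ennreal (exp (g x) * ?w x)" for x
    proof -
      obtain N :: nat where N: "\<bar>x\<bar> \<le> real N" using real_arch_simple by blast
      have "eventually (\<lambda>n. ?h n x = ennreal (exp (g x) * ?w x)) sequentially"
        using eventually_ge_at_top[of N] by eventually_elim (use N in \<open>auto simp: indicator_def\<close>)
      then show ?thesis by (rule tendsto_eventually)
    qed
  qed auto
  moreover have "integral\<^sup>N lborel (?h n) = ennreal (B n)" for n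
  proof -
    have i: "integrable lborel (\<lambda>x. indicator (?J n) x * (exp (g x) * ?w x))"
      using borel_integrable_atLeastAtMost'[OF cB] by (simp add: set_integrable_def)
    have "B n = (\<integral>x. indicator (?J n) x * (exp (g x) * ?w x) \<partial>lborel)"
      using set_borel_integral_eq_integral(2)[OF borel_integrable_atLeastAtMost'[OF cB]]
      by (simp add: set_lebesgue_integral_def B_def)
    then show ?thesis
      using nn_integral_eq_integral[OF i] by (simp add: indicator_def normal_density_nonneg)
  qed
  ultimately have L: "(\<lambda>n. ennreal (B n)) \<longlonglongrightarrow> (\<integral>\<^sup>+x. ennreal (exp (g x) * ?w x) \<partial>lborel)" by simp
  have "(\<integral>\<^sup>+x. ennreal (exp (g x)) \<partial>std_gaussian) = (\<integral>\<^sup>+x. ennreal (exp (g x) * ?w x) \<partial>lborel)"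
    by (subst nn_integral_density) (auto simp: ennreal_mult' mult.commute normal_density_nonneg)
  also have "\<dots> \<le> ennreal (exp (\<integral>x. f x \<partial>std_gaussian))"
    by (rule LIMSEQ_le[OF L R]) (auto intro!: exI[of _ 0] ennreal_leI Bn)
  finally show ?thesis .
qed

section \<open>The exponential inequality for product Gaussian measures\<close>

lemma prob_space_std_gaussian: "prob_space std_gaussian"
  by (rule prob_space_normal_density) simp

lemma product_sigma_finite_std_gaussian: "product_sigma_finite (\<lambda>_. std_gaussian)"
  unfolding product_sigma_finite_def
  using prob_space_std_gaussian prob_space_imp_sigma_finite by blast

lemma integrable_abs_std_gaussian: "integrable std_gaussian (\<lambda>x. \<bar>x\<bar>)"
  using integrable_std_normal_moment_abs[of 1]
  by (subst integrable_density) (auto simp: normal_density_nonneg)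

text \<open>
  This is the regularity that makes integrals finite and sections continuous.  The sum over
  coordinates, instead of a Euclidean norm, splits off one coordinate additively.  The condition
  quantifies over all functions, not only those that are extensional on \<open>I\<close>, so that coordinates
  can be fixed by function update.
\<close>

definition lipschitz_coord :: "'i set \<Rightarrow> real \<Rightarrow> (('i \<Rightarrow> real) \<Rightarrow> real) \<Rightarrow> bool" where
  "lipschitz_coord I L F \<longleftrightarrow> (\<forall>x y. \<bar>F x - F y\<bar> \<le> L * (\<Sum>i\<in>I. \<bar>x i - y i\<bar>))"

lemma integrable_lipschitz_coord:
  assumes I: "finite I" and F: "lipschitz_coord I L F"
    and [measurable]: "F \<in> borel_measurable (PiM I (\<lambda>_. std_gaussian))"
  shows "integrable (PiM I (\<lambda>_. std_gaussian)) F"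
proof -
  let ?M = "PiM I (\<lambda>_. std_gaussian)"
  interpret P: prob_space ?M by (rule prob_space_PiM) (rule prob_space_std_gaussian)
  have "integrable ?M (\<lambda>x. \<bar>x i\<bar>)" if "i \<in> I" for i
  proof -
    have "distr ?M std_gaussian (\<lambda>x. x i) = std_gaussian"
      using that prob_space_std_gaussian by (intro distr_PiM_component)
    then have "integrable (distr ?M std_gaussian (\<lambda>x. x i)) (\<lambda>x. \<bar>x\<bar>)"
      using integrable_abs_std_gaussian by simp
    then show ?thesis
      using that by (subst (asm) integrable_distr_eq) auto
  qed
  then have "integrable ?M (\<lambda>x. \<bar>F (\<lambda>_. 0)\<bar> + L * (\<Sum>i\<in>I. \<bar>x i\<bar>))"
    by (intro Bochner_Integration.integrable_add integrable_mult_right Bochner_Integration.integrable_sum) auto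
  then show ?thesis
  proof (rule Bochner_Integration.integrable_bound)
    show "AE x in ?M. norm (F x) \<le> norm (\<bar>F (\<lambda>_. 0)\<bar> + L * (\<Sum>i\<in>I. \<bar>x i\<bar>))"
    proof (rule AE_I2)
      fix x
      have "\<bar>F x - F (\<lambda>_. 0)\<bar> \<le> L * (\<Sum>i\<in>I. \<bar>x i\<bar>)"
        using F[unfolded lipschitz_coord_def, rule_format, of x "\<lambda>_. 0"] by simp
      then show "norm (F x) \<le> norm (\<bar>F (\<lambda>_. 0)\<bar> + L * (\<Sum>i\<in>I. \<bar>x i\<bar>))" by simp
    qed
  qed simp
qed

lemma continuous_on_if_abs_diff_le:
  fixes f :: "'a::real_normed_vector \<Rightarrow> real"
  assumes "\<And>x y. \<bar>f x - f y\<bar> \<le> L * norm (x - y)"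
  shows "continuous_on S f"
proof -
  have "\<bar>L\<bar>-lipschitz_on UNIV f"
  proof (rule lipschitz_onI)
    fix x y
    have "\<bar>f x - f y\<bar> \<le> L * norm (x - y)" by fact
    also have "\<dots> \<le> \<bar>L\<bar> * norm (x - y)" by (intro mult_right_mono) auto
    finally show "dist (f x) (f y) \<le> \<bar>L\<bar> * dist x y" by (simp add: dist_norm)
  qed simp
  then show ?thesis
    using lipschitz_on_continuous_on continuous_on_subset by blast
qed

text \<open>
  Induction on the set of coordinates.  For the new coordinate $u$, let $h(x) = \int F(x, u) \, du$ and
  $k(x) = \ln \int e^{G(x, u)} \, du$, both integrals with respect to the Gaussian measure.  For fixed
  $x$ and $y$, the one-dimensional inequality applied to $G(x, \cdot)$ and $F(y, \cdot) + |x - y|^2/2$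
  says $k(x) \le h(y) + |x - y|^2/2$, so the induction hypothesis applies to $h$ and $k$.
\<close>

theorem product_gaussian_exp_transport_bound:
  assumes "finite I" "lipschitz_coord I L F" "lipschitz_coord I L G"
    and "F \<in> borel_measurable (PiM I (\<lambda>_. std_gaussian))"
    and "G \<in> borel_measurable (PiM I (\<lambda>_. std_gaussian))"
    and "\<And>x y. G x \<le> F y + (\<Sum>i\<in>I. (x i - y i)\<^sup>2) / 2"
  shows "(\<integral>\<^sup>+x. ennreal (exp (G x)) \<partial>PiM I (\<lambda>_. std_gaussian))
    \<le> ennreal (exp (\<integral>x. F x \<partial>PiM I (\<lambda>_. std_gaussian)))"
  using assms
proof (induction I arbitrary: F G rule: finite_induct)
  case empty
  show ?case using empty(5)[of "\<lambda>_. undefined" "\<lambda>_. undefined"]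
    by (simp add: PiM_empty nn_integral_count_space_finite lebesgue_integral_count_space_finite)
next
  case (insert i I F G)
  let ?\<gamma> = std_gaussian
  let ?M = "PiM I (\<lambda>_. ?\<gamma>)"
  interpret g: prob_space ?\<gamma> by (rule prob_space_std_gaussian)
  have prob_UNIV: "measure ?\<gamma> UNIV = 1" using g.prob_space by simp
  interpret product_sigma_finite "\<lambda>_. ?\<gamma>" by (rule product_sigma_finite_std_gaussian)
  note [measurable] = insert.prems(3,4)
  have sec: "(\<Sum>j\<in>insert i I. d ((x(i := u)) j) ((y(i := v)) j)) = d u v + (\<Sum>j\<in>I. d (x j) (y j))"
    for d :: "real \<Rightarrow> real \<Rightarrow> real" and x y :: "'a \<Rightarrow> real" and u v
    using insert.hyps by (auto intro!: sum.cong)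
  have lipF: "\<bar>F (x(i := u)) - F (y(i := v))\<bar> \<le> L * \<bar>u - v\<bar> + L * (\<Sum>j\<in>I. \<bar>x j - y j\<bar>)"
    and lipG: "\<bar>G (x(i := u)) - G (y(i := v))\<bar> \<le> L * \<bar>u - v\<bar> + L * (\<Sum>j\<in>I. \<bar>x j - y j\<bar>)" for x y u v
    using insert.prems(1,2) sec[of "\<lambda>a b. \<bar>a - b\<bar>" x u y v]
    unfolding lipschitz_coord_def by (metis distrib_left)+
  have lipF1: "\<bar>F (x(i := u)) - F (x(i := v))\<bar> \<le> L * norm (u - v)"
    and lipG1: "\<bar>G (x(i := u)) - G (x(i := v))\<bar> \<le> L * norm (u - v)" for x u v
    using lipF[of x u x v] lipG[of x u x v] by auto
  have intF: "integrable ?\<gamma> (\<lambda>u. F (x(i := u)))" for x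
  proof (rule Bochner_Integration.integrable_bound)
    show "integrable ?\<gamma> (\<lambda>u. \<bar>F (x(i := 0))\<bar> + L * \<bar>u\<bar>)"
      by (intro Bochner_Integration.integrable_add integrable_mult_right integrable_abs_std_gaussian) auto
    have "continuous_on UNIV (\<lambda>u. F (x(i := u)))"
      using lipF1 by (rule continuous_on_if_abs_diff_le)
    from borel_measurable_continuous_onI[OF this]
    show "(\<lambda>u. F (x(i := u))) \<in> borel_measurable ?\<gamma>" by simp
    show "AE u in ?\<gamma>. norm (F (x(i := u))) \<le> norm (\<bar>F (x(i := 0))\<bar> + L * \<bar>u\<bar>)"
    proof (rule AE_I2)
      fix u show "norm (F (x(i := u))) \<le> norm (\<bar>F (x(i := 0))\<bar> + L * \<bar>u\<bar>)"
        using lipF1[of x u 0] by simp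
    qed
  qed
  define h where "h = (\<lambda>x. \<integral>u. F (x(i := u)) \<partial>?\<gamma>)"
  define E where "E = (\<lambda>x. \<integral>\<^sup>+u. ennreal (exp (G (x(i := u)))) \<partial>?\<gamma>)"
  define k where "k = (\<lambda>x. ln (enn2real (E x)))"
  have Ele: "E x \<le> ennreal (exp (h y + (\<Sum>j\<in>I. (x j - y j)\<^sup>2) / 2))" for x y
  proof -
    let ?c = "(\<Sum>j\<in>I. (x j - y j)\<^sup>2) / 2"
    have "E x \<le> ennreal (exp (\<integral>u. F (y(i := u)) + ?c \<partial>?\<gamma>))"
      unfolding E_def
    proof (rule gaussian_exp_transport_bound)
      show "continuous_on UNIV (\<lambda>u. F (y(i := u)) + ?c)" "continuous_on UNIV (\<lambda>u. G (x(i := u)))"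
        by (intro continuous_intros continuous_on_if_abs_diff_le[of "\<lambda>u. F (y(i := u))", OF lipF1]
            continuous_on_if_abs_diff_le[of "\<lambda>u. G (x(i := u))", OF lipG1])+
      show "G (x(i := u)) \<le> F (y(i := v)) + ?c + (u - v)\<^sup>2 / 2" for u v
        using insert.prems(5)[of "x(i := u)" "y(i := v)"] sec[of "\<lambda>a b. (a - b)\<^sup>2" x u y v]
        by (simp add: add_divide_distrib del: fun_upd_apply)
      show "integrable ?\<gamma> (\<lambda>u. F (y(i := u)) + ?c)"
        using intF by auto
    qed
    also have "(\<integral>u. F (y(i := u)) + ?c \<partial>?\<gamma>) = h y + ?c"
      using intF[of y] by (simp add: h_def prob_UNIV)
    finally show ?thesis .
  qed
  have Epos: "0 < E x" for x
  proof -
    have "(\<lambda>u. G (x(i := u))) \<in> borel_measurable borel"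
      using continuous_on_if_abs_diff_le[of "\<lambda>u. G (x(i := u))", OF lipG1]
      by (intro borel_measurable_continuous_onI)
    then have m: "(\<lambda>u. ennreal (exp (G (x(i := u))))) \<in> borel_measurable ?\<gamma>" by simp
    have "E x \<noteq> 0"
      unfolding E_def using nn_integral_0_iff_AE[OF m] g.emeasure_space_1
      by (auto simp: g.AE_False)
    then show ?thesis by (simp add: zero_less_iff_neq_zero)
  qed
  have Ek: "E x = ennreal (exp (k x))" for x
  proof -
    have "E x < top" using Ele[of x x] by (simp add: order_le_less_trans)
    then have "0 < enn2real (E x)" using Epos[of x] by (simp add: enn2real_positive_iff)
    then show ?thesis using \<open>E x < top\<close> by (simp add: k_def)
  qed
  have "(\<integral>\<^sup>+x. ennreal (exp (G x)) \<partial>PiM (insert i I) (\<lambda>_. ?\<gamma>)) = (\<integral>\<^sup>+x. E x \<partial>?M)"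
    unfolding E_def by (rule product_nn_integral_insert) (use insert.hyps in auto)
  also have "\<dots> = (\<integral>\<^sup>+x. ennreal (exp (k x)) \<partial>?M)" by (simp add: Ek)
  also have "\<dots> \<le> ennreal (exp (\<integral>x. h x \<partial>?M))"
  proof (rule insert.IH)
    show "lipschitz_coord I L h"
      unfolding lipschitz_coord_def
    proof (intro allI)
      fix x y
      have "\<bar>h x - h y\<bar> = \<bar>\<integral>u. F (x(i := u)) - F (y(i := u)) \<partial>?\<gamma>\<bar>"
        unfolding h_def using intF by simp
      also have "\<dots> \<le> (\<integral>u. \<bar>F (x(i := u)) - F (y(i := u))\<bar> \<partial>?\<gamma>)"
        by (rule integral_abs_bound)
      also have "\<dots> \<le> (\<integral>u. L * (\<Sum>j\<in>I. \<bar>x j - y j\<bar>) \<partial>?\<gamma>)"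
      proof (rule integral_mono)
        show "integrable ?\<gamma> (\<lambda>u. \<bar>F (x(i := u)) - F (y(i := u))\<bar>)"
          by (intro integrable_abs Bochner_Integration.integrable_diff intF)
        show "\<bar>F (x(i := u)) - F (y(i := u))\<bar> \<le> L * (\<Sum>j\<in>I. \<bar>x j - y j\<bar>)" for u
          using lipF[of x u y u] by simp
      qed simp
      finally show "\<bar>h x - h y\<bar> \<le> L * (\<Sum>j\<in>I. \<bar>x j - y j\<bar>)" by (simp add: prob_UNIV)
    qed
    show "lipschitz_coord I L k"
    proof -
      have "k x \<le> k y + L * (\<Sum>j\<in>I. \<bar>x j - y j\<bar>)" for x y
      proof -
        let ?d = "L * (\<Sum>j\<in>I. \<bar>x j - y j\<bar>)"
        have "(\<lambda>u. G (y(i := u))) \<in> borel_measurable borel"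
          using continuous_on_if_abs_diff_le[of "\<lambda>u. G (y(i := u))", OF lipG1]
          by (intro borel_measurable_continuous_onI)
        then have m: "(\<lambda>u. ennreal (exp (G (y(i := u))))) \<in> borel_measurable ?\<gamma>" by simp
        have "E x \<le> (\<integral>\<^sup>+u. ennreal (exp ?d) * ennreal (exp (G (y(i := u)))) \<partial>?\<gamma>)"
          unfolding E_def
        proof (rule nn_integral_mono)
          fix u
          have "G (x(i := u)) \<le> ?d + G (y(i := u))" using lipG[of x u y u] by simp
          then show "ennreal (exp (G (x(i := u)))) \<le> ennreal (exp ?d) * ennreal (exp (G (y(i := u))))"
            by (simp add: ennreal_mult[symmetric] exp_add[symmetric])
        qed
        also have "\<dots> = ennreal (exp ?d) * E y"
          unfolding E_def by (rule nn_integral_cmult[OF m])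
        finally have "exp (k x) \<le> exp ?d * exp (k y)"
          unfolding Ek by (simp add: ennreal_mult[symmetric])
        then show ?thesis by (simp add: exp_add[symmetric] add.commute)
      qed
      from this[of _ _] show ?thesis
        unfolding lipschitz_coord_def by (smt (verit) abs_minus_commute sum.cong)
    qed
    show "h \<in> borel_measurable ?M"
      unfolding h_def by measurable
    have "E \<in> borel_measurable ?M"
      unfolding E_def by measurable
    then show "k \<in> borel_measurable ?M"
      unfolding k_def by measurable
    show "k x \<le> h y + (\<Sum>j\<in>I. (x j - y j)\<^sup>2) / 2" for x y
      using Ele[of x y] unfolding Ek by simp
  qed
  also have "(\<integral>x. h x \<partial>?M) = (\<integral>x. F x \<partial>PiM (insert i I) (\<lambda>_. ?\<gamma>))"
    unfolding h_def using insert.hyps insert.prems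
    by (intro product_integral_insert[symmetric] integrable_lipschitz_coord[where L=L]) auto
  finally show ?case .
qed


section \<open>Concentration of Lipschitz functions of a Gaussian vector\<close>

lemma Basis_vec_eq: "(Basis :: (real ^ 'n) set) = range (\<lambda>i. axis i 1)"
  by (auto simp: Basis_vec_def)

lemma distr_coordinates_std_gaussian_vector:
  fixes Z :: "'s \<Rightarrow> real ^ 'n"
  assumes Z: "std_gaussian_vector M Z"
  shows "distr M (PiM Basis (\<lambda>_. std_gaussian)) (\<lambda>\<omega>. \<lambda>b\<in>Basis. Z \<omega> \<bullet> b) = PiM Basis (\<lambda>_. std_gaussian)"
proof -
  interpret product_sigma_finite "\<lambda>_::real ^ 'n. std_gaussian" by (rule product_sigma_finite_std_gaussian)
  let ?dens = "\<lambda>z::real ^ 'n. ennreal (\<Prod>i\<in>UNIV. std_normal_density (z $ i))"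
  let ?X = "\<lambda>\<omega>. \<lambda>b\<in>Basis. Z \<omega> \<bullet> b"
  have D: "distributed M lborel Z ?dens" using Z by (simp add: std_gaussian_vector_def)
  have [measurable]: "Z \<in> borel_measurable M" using distributed_measurable[OF D] by simp
  have mX [measurable]: "?X \<in> measurable M (PiM Basis (\<lambda>_. std_gaussian))"
    by (rule measurable_restrict) simp
  have dens: "?dens z = (\<Prod>b\<in>Basis. ennreal (std_normal_density (z \<bullet> b)))" for z
  proof -
    have "inj (\<lambda>i::'n. axis i (1::real))" by (auto intro!: injI simp: axis_eq_axis)
    then have "(\<Prod>b\<in>Basis. std_normal_density (z \<bullet> b)) = (\<Prod>i\<in>UNIV. std_normal_density (z $ i))"
      unfolding Basis_vec_eq by (subst prod.reindex) (auto simp: cart_eq_inner_axis)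
    then show ?thesis by (simp add: prod_ennreal normal_density_nonneg)
  qed
  show ?thesis
  proof (rule PiM_eqI)
    fix A :: "real ^ 'n \<Rightarrow> real set" assume "\<And>b. b \<in> Basis \<Longrightarrow> A b \<in> sets std_gaussian"
    then have A [measurable]: "\<And>b. b \<in> Basis \<Longrightarrow> A b \<in> sets borel" by simp
    define S where "S = {z::real ^ 'n. \<forall>b\<in>Basis. z \<bullet> b \<in> A b}"
    have [measurable]: "S \<in> sets borel"
    proof -
      have "{z \<in> space borel. z \<bullet> b \<in> A b} \<in> sets borel" if "b \<in> Basis" for b :: "real ^ 'n"
        using measurable_sets[of "\<lambda>z. z \<bullet> b" borel borel "A b"] A[OF that] by (simp add: vimage_def)
      then have "{z \<in> space borel. \<forall>b\<in>Basis. z \<bullet> b \<in> A b} \<in> sets borel"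
        by (intro sets.sets_Collect_finite_All finite_Basis) auto
      then show ?thesis by (simp add: S_def)
    qed
    have "emeasure (distr M (PiM Basis (\<lambda>_. std_gaussian)) ?X) (Pi\<^sub>E Basis A) = emeasure M (Z -` S \<inter> space M)"
      by (subst emeasure_distr) (auto simp: S_def PiE_iff intro!: sets_PiM_I_finite arg_cong[where f="emeasure M"])
    also have "\<dots> = (\<integral>\<^sup>+z. ?dens z * indicator S z \<partial>lborel)"
      by (rule distributed_emeasure[OF D]) simp
    also have "\<dots> = (\<integral>\<^sup>+z. (\<Prod>b\<in>Basis. ennreal (std_normal_density (z \<bullet> b)) * indicator (A b) (z \<bullet> b)) \<partial>lborel)"
    proof (rule nn_integral_cong)
      fix z
      have "indicator S z = (\<Prod>b\<in>Basis. indicator (A b) (z \<bullet> b) :: ennreal)"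
      proof (cases "z \<in> S")
        case False
        then obtain b where "b \<in> Basis" "z \<bullet> b \<notin> A b" by (auto simp: S_def)
        then have "(\<Prod>b\<in>Basis. indicator (A b) (z \<bullet> b) :: ennreal) = 0"
          by (intro prod_zero bexI[of _ b]) auto
        then show ?thesis using False by simp
      qed (auto simp: S_def)
      then show "?dens z * indicator S z
          = (\<Prod>b\<in>Basis. ennreal (std_normal_density (z \<bullet> b)) * indicator (A b) (z \<bullet> b))"
        by (simp add: dens prod.distrib)
    qed
    also have "\<dots> = (\<Prod>b\<in>Basis. \<integral>\<^sup>+x. ennreal (std_normal_density x) * indicator (A b) x \<partial>lborel)"
      by (rule nn_integral_lborel_prod) auto
    also have "\<dots> = (\<Prod>b\<in>Basis. emeasure std_gaussian (A b))"
      by (intro prod.cong refl) (simp add: emeasure_density)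
    finally show "emeasure (distr M (PiM Basis (\<lambda>_. std_gaussian)) ?X) (Pi\<^sub>E Basis A)
        = (\<Prod>b\<in>Basis. emeasure std_gaussian (A b))" .
  qed auto
qed

context
  fixes M :: "'s measure" and Z :: "'s \<Rightarrow> real ^ 'n" and f :: "real ^ 'n \<Rightarrow> real" and L :: real
  assumes M: "prob_space M" and Z: "std_gaussian_vector M Z"
    and lip: "\<And>x y. \<bar>f x - f y\<bar> \<le> L * norm (x - y)"
begin

interpretation prob_space M by (rule M)

private abbreviation (input) "\<Gamma> \<equiv> PiM (Basis :: (real ^ 'n) set) (\<lambda>_. std_gaussian)"

text \<open>
  The inverse of taking coordinates, so that functions of \<open>Z\<close> become functions on the product
  space \<open>\<Gamma>\<close>.
\<close>

private definition "vec_of x = (\<Sum>b\<in>Basis. x b *\<^sub>R b)" for x :: "real ^ 'n \<Rightarrow> real"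

private lemma meas_f [measurable]: "f \<in> borel_measurable borel"
  by (rule borel_measurable_continuous_onI[OF continuous_on_if_abs_diff_le[OF lip]])

private lemma [measurable]: "Z \<in> borel_measurable M"
  using Z distributed_measurable unfolding std_gaussian_vector_def by fastforce

private lemma mX: "(\<lambda>\<omega>. \<lambda>b\<in>Basis. Z \<omega> \<bullet> b) \<in> measurable M \<Gamma>"
  by (rule measurable_restrict) simp

private lemma vec_of_coords: "vec_of (\<lambda>b\<in>Basis. z \<bullet> b) = z"
  unfolding vec_of_def by (simp add: euclidean_representation)

private lemma measurable_vec_of [measurable]: "vec_of \<in> borel_measurable \<Gamma>"
  unfolding vec_of_def[abs_def] by measurable

private lemma vec_of_diff: "vec_of x - vec_of y = vec_of (\<lambda>b. x b - y b)"
  by (simp add: vec_of_def sum_subtractf scaleR_diff_left)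

private lemma norm_vec_of_le: "norm (vec_of x) \<le> (\<Sum>b\<in>Basis. \<bar>x b\<bar>)"
proof -
  have "norm (vec_of x) \<le> (\<Sum>b\<in>Basis. norm (x b *\<^sub>R b))"
    unfolding vec_of_def by (rule norm_sum)
  then show ?thesis by simp
qed

private lemma norm_vec_of_sq: "(norm (vec_of x))\<^sup>2 = (\<Sum>b\<in>Basis. (x b)\<^sup>2)"
proof -
  have "vec_of x \<bullet> b = x b" if "b \<in> Basis" for b
    unfolding vec_of_def using that by simp
  then show ?thesis
    using euclidean_inner[of "vec_of x" "vec_of x"] unfolding power2_norm_eq_inner by (simp add: power2_eq_square)
qed

private lemma transfer_integral:
  fixes g :: "real ^ 'n \<Rightarrow> real"
  assumes [measurable]: "g \<in> borel_measurable borel"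
  shows "integrable M (\<lambda>\<omega>. g (Z \<omega>)) \<longleftrightarrow> integrable \<Gamma> (\<lambda>x. g (vec_of x))"
    and "(\<integral>\<omega>. g (Z \<omega>) \<partial>M) = (\<integral>x. g (vec_of x) \<partial>\<Gamma>)"
    and "(\<integral>\<^sup>+\<omega>. ennreal (g (Z \<omega>)) \<partial>M) = (\<integral>\<^sup>+x. ennreal (g (vec_of x)) \<partial>\<Gamma>)"
proof -
  note d = distr_coordinates_std_gaussian_vector[OF Z]
  have m: "(\<lambda>x. g (vec_of x)) \<in> borel_measurable \<Gamma>" by measurable
  show "integrable M (\<lambda>\<omega>. g (Z \<omega>)) \<longleftrightarrow> integrable \<Gamma> (\<lambda>x. g (vec_of x))"
    using integrable_distr_eq[OF mX m] unfolding d vec_of_coords by simp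
  show "(\<integral>\<omega>. g (Z \<omega>) \<partial>M) = (\<integral>x. g (vec_of x) \<partial>\<Gamma>)"
    using integral_distr[OF mX m] unfolding d vec_of_coords by simp
  show "(\<integral>\<^sup>+\<omega>. ennreal (g (Z \<omega>)) \<partial>M) = (\<integral>\<^sup>+x. ennreal (g (vec_of x)) \<partial>\<Gamma>)"
    using nn_integral_distr[OF mX, of "\<lambda>x. ennreal (g (vec_of x))"] m unfolding d vec_of_coords by simp
qed

private lemma lipschitz_coord_f: "lipschitz_coord Basis (\<bar>l\<bar> * \<bar>L\<bar>) (\<lambda>x. l * f (vec_of x) + c)"
  unfolding lipschitz_coord_def
proof (intro allI)
  fix x y
  have "\<bar>f (vec_of x) - f (vec_of y)\<bar> \<le> L * norm (vec_of x - vec_of y)" by (rule lip)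
  also have "\<dots> \<le> \<bar>L\<bar> * norm (vec_of x - vec_of y)" by (intro mult_right_mono) auto
  also have "\<dots> \<le> \<bar>L\<bar> * (\<Sum>b\<in>Basis. \<bar>x b - y b\<bar>)"
    unfolding vec_of_diff by (intro mult_left_mono norm_vec_of_le) simp
  finally have "\<bar>l\<bar> * \<bar>f (vec_of x) - f (vec_of y)\<bar> \<le> \<bar>l\<bar> * (\<bar>L\<bar> * (\<Sum>b\<in>Basis. \<bar>x b - y b\<bar>))"
    by (rule mult_left_mono) simp
  moreover have "\<bar>l * f (vec_of x) + c - (l * f (vec_of y) + c)\<bar> = \<bar>l\<bar> * \<bar>f (vec_of x) - f (vec_of y)\<bar>"
    by (simp add: abs_mult[symmetric] right_diff_distrib)
  ultimately show "\<bar>l * f (vec_of x) + c - (l * f (vec_of y) + c)\<bar> \<le> \<bar>l\<bar> * \<bar>L\<bar> * (\<Sum>b\<in>Basis. \<bar>x b - y b\<bar>)"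
    by (simp add: mult.assoc)
qed

lemma integrable_lipschitz_gaussian: "integrable M (\<lambda>\<omega>. f (Z \<omega>))"
  using lipschitz_coord_f[of 1 0] unfolding transfer_integral(1)[OF meas_f]
  by (intro integrable_lipschitz_coord[where L="\<bar>1\<bar> * \<bar>L\<bar>"]) auto

text \<open>
  The optimal choice in the exponential inequality is $F = l f$ and $G = l f - l^2 L^2/2$: the
  hypothesis on the pair is $l L \, |x - y| \le l^2 L^2/2 + |x - y|^2/2$.
\<close>

lemma gaussian_lipschitz_mgf_bound:
  "(\<integral>\<^sup>+\<omega>. ennreal (exp (l * f (Z \<omega>))) \<partial>M) \<le> ennreal (exp (l * (\<integral>\<omega>. f (Z \<omega>) \<partial>M) + l\<^sup>2 * L\<^sup>2 / 2))"
proof -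
  let ?c = "l\<^sup>2 * L\<^sup>2 / 2"
  have "(\<integral>\<^sup>+\<omega>. ennreal (exp (l * f (Z \<omega>))) \<partial>M) = (\<integral>\<^sup>+\<omega>. ennreal (exp ?c) * ennreal (exp (l * f (Z \<omega>) + - ?c)) \<partial>M)"
    by (simp add: ennreal_mult[symmetric] exp_add[symmetric])
  also have "\<dots> = ennreal (exp ?c) * (\<integral>\<^sup>+\<omega>. ennreal (exp (l * f (Z \<omega>) + - ?c)) \<partial>M)"
    by (rule nn_integral_cmult) simp
  also have "(\<integral>\<^sup>+\<omega>. ennreal (exp (l * f (Z \<omega>) + - ?c)) \<partial>M)
      = (\<integral>\<^sup>+x. ennreal (exp (l * f (vec_of x) + - ?c)) \<partial>\<Gamma>)"
    by (rule transfer_integral(3)[of "\<lambda>z. exp (l * f z + - ?c)"]) simp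
  also have "\<dots> \<le> ennreal (exp (\<integral>x. l * f (vec_of x) + 0 \<partial>\<Gamma>))"
  proof (rule product_gaussian_exp_transport_bound[OF finite_Basis lipschitz_coord_f lipschitz_coord_f])
    fix x y :: "real ^ 'n \<Rightarrow> real"
    let ?d = "norm (vec_of x - vec_of y)"
    have "l * f (vec_of x) - l * f (vec_of y) \<le> \<bar>l\<bar> * \<bar>f (vec_of x) - f (vec_of y)\<bar>"
      by (simp add: abs_mult[symmetric] right_diff_distrib)
    also have "\<dots> \<le> \<bar>l\<bar> * (L * ?d)" by (intro mult_left_mono lip) simp
    also have "\<dots> \<le> (l\<^sup>2 * L\<^sup>2 + ?d\<^sup>2) / 2"
      using sum_squares_bound[of "\<bar>l\<bar> * L" ?d] by (simp add: power_mult_distrib field_simps)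
    finally show "l * f (vec_of x) + - ?c \<le> l * f (vec_of y) + 0 + (\<Sum>b\<in>Basis. (x b - y b)\<^sup>2) / 2"
      unfolding vec_of_diff norm_vec_of_sq by (simp add: field_simps)
  qed auto
  also have "(\<integral>x. l * f (vec_of x) + 0 \<partial>\<Gamma>) = l * (\<integral>\<omega>. f (Z \<omega>) \<partial>M)"
    by (simp add: transfer_integral(2))
  finally show ?thesis
    by (simp add: ennreal_mult[symmetric] exp_add[symmetric] add.commute mult_left_mono)
qed

theorem gaussian_lipschitz_concentration:
  assumes L: "0 < L" and d: "0 \<le> d"
  shows "measure M {\<omega> \<in> space M. f (Z \<omega>) \<ge> (\<integral>\<omega>. f (Z \<omega>) \<partial>M) + d} \<le> exp (- d\<^sup>2 / (2 * L\<^sup>2))"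
proof -
  let ?m = "\<integral>\<omega>. f (Z \<omega>) \<partial>M"
  let ?A = "{\<omega> \<in> space M. f (Z \<omega>) \<ge> ?m + d}"
  \<comment> \<open>This is the minimizer of the Chernoff exponent \<open>l\<^sup>2 * L\<^sup>2 / 2 - l * d\<close>.\<close>
  define l where "l = d / L\<^sup>2"
  have l: "0 \<le> l" using L d by (simp add: l_def)
  have "ennreal (exp (l * (?m + d))) * emeasure M ?A = (\<integral>\<^sup>+\<omega>. ennreal (exp (l * (?m + d))) * indicator ?A \<omega> \<partial>M)"
    by (rule nn_integral_cmult_indicator[symmetric]) measurable
  also have "\<dots> \<le> (\<integral>\<^sup>+\<omega>. ennreal (exp (l * f (Z \<omega>))) \<partial>M)"
    using l by (intro nn_integral_mono) (auto simp: indicator_def intro!: ennreal_leI mult_left_mono)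
  also have "\<dots> \<le> ennreal (exp (l * ?m + l\<^sup>2 * L\<^sup>2 / 2))" by (rule gaussian_lipschitz_mgf_bound)
  finally have "exp (l * (?m + d)) * measure M ?A \<le> exp (l * ?m + l\<^sup>2 * L\<^sup>2 / 2)"
    by (simp add: emeasure_eq_measure ennreal_mult[symmetric])
  then have "measure M ?A \<le> exp (l * ?m + l\<^sup>2 * L\<^sup>2 / 2) / exp (l * (?m + d))"
    by (simp add: field_simps)
  also have "\<dots> = exp (l\<^sup>2 * L\<^sup>2 / 2 - l * d)"
    by (simp add: exp_diff[symmetric] algebra_simps)
  also have "l\<^sup>2 * L\<^sup>2 / 2 - l * d = - d\<^sup>2 / (2 * L\<^sup>2)"
    using L by (simp add: l_def power2_eq_square field_simps)
  finally show ?thesis .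
qed

end

section \<open>Strong concavity and extended expectations\<close>

text \<open>
  Strong concavity between $s$ and $t$, together with maximality at $s$, gives
  $f(t) + (1 - u)(s - t)^2/2 \le f(s)$ for $0 < u < 1$, after division by $u$.  Only the limit $u \to 0$ yields the full constant $1/2$.
\<close>

lemma strongly_concave_max_gap:
  fixes f :: "real \<Rightarrow> real"
  assumes conc: "\<And>u. 0 < u \<Longrightarrow> u < 1 \<Longrightarrow> (1 - u) * f s + u * f t + u * (1 - u) * (s - t)\<^sup>2 / 2 \<le> f ((1 - u) * s + u * t)"
    and max: "\<And>u. 0 < u \<Longrightarrow> u < 1 \<Longrightarrow> f ((1 - u) * s + u * t) \<le> f s"
  shows "f t + (s - t)\<^sup>2 / 2 \<le> f s"
proof (rule tendsto_upperbound)
  show "((\<lambda>u. f t + (1 - u) * (s - t)\<^sup>2 / 2) \<longlongrightarrow> f t + (s - t)\<^sup>2 / 2) (at_right 0)"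
    by (auto intro!: tendsto_eq_intros)
  have "f t + (1 - u) * (s - t)\<^sup>2 / 2 \<le> f s" if u: "0 < u" "u < 1" for u
  proof -
    have "u * (f t + (1 - u) * (s - t)\<^sup>2 / 2) \<le> u * f s"
      using conc[OF u] max[OF u] by (simp add: algebra_simps)
    then show ?thesis using u by simp
  qed
  then show "eventually (\<lambda>u. f t + (1 - u) * (s - t)\<^sup>2 / 2 \<le> f s) (at_right 0)"
    unfolding eventually_at_right_field by (intro exI[of _ 1]) auto
qed simp

lemma ereal_expectation_integrable:
  assumes "integrable M X"
  shows "ereal_expectation M (\<lambda>\<omega>. ereal (X \<omega>)) = ereal (\<integral>\<omega>. X \<omega> \<partial>M)"
proof -
  have e: "e2ennreal (ereal x) = ennreal x" for x by (simp add: ennreal_def)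
  have "(\<integral>\<^sup>+\<omega>. ennreal (X \<omega>) \<partial>M) \<noteq> top" "(\<integral>\<^sup>+\<omega>. ennreal (- X \<omega>) \<partial>M) \<noteq> top"
    using assms by (auto simp: real_integrable_def)
  then show ?thesis
    unfolding ereal_expectation_def real_lebesgue_integral_def[OF assms]
    by (cases "\<integral>\<^sup>+\<omega>. ennreal (X \<omega>) \<partial>M"; cases "\<integral>\<^sup>+\<omega>. ennreal (- X \<omega>) \<partial>M") (auto simp: e)
qed


section \<open>The support function of a slice of a convex set\<close>

definition slice_support :: "(real ^ 'n) set \<Rightarrow> real ^ 'n \<Rightarrow> real \<Rightarrow> real ^ 'n \<Rightarrow> real" where
  "slice_support K \<mu> t z = (SUP \<nu>\<in>{\<nu> \<in> K. norm (\<nu> - \<mu>) \<le> t}. z \<bullet> (\<nu> - \<mu>))"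

context
  fixes K :: "(real ^ 'n) set" and \<mu> :: "real ^ 'n"
  assumes K: "K \<noteq> {}" "closed K" "convex K"
begin

private abbreviation (input) "tc \<equiv> t_crit K \<mu>"
private abbreviation (input) "m \<equiv> slice_support K \<mu>"
private abbreviation (input) "\<nu>\<^sub>0 \<equiv> closest_point K \<mu>"

private lemma nu0: "\<nu>\<^sub>0 \<in> K"
  using K closest_point_in_set by blast

lemma t_crit_eq: "tc = norm (\<nu>\<^sub>0 - \<mu>)"
proof -
  have "norm (\<nu>\<^sub>0 - \<mu>) \<le> norm (\<nu> - \<mu>)" if "\<nu> \<in> K" for \<nu>
    using closest_point_le[OF K(2) that, of \<mu>] by (simp add: dist_norm norm_minus_commute)
  then show ?thesis
    unfolding t_crit_def using nu0 by (intro cInf_eq_minimum) auto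
qed

lemma t_crit_le: "\<nu> \<in> K \<Longrightarrow> tc \<le> norm (\<nu> - \<mu>)"
  using closest_point_le[OF K(2), of \<nu> \<mu>] unfolding t_crit_eq by (simp add: dist_norm norm_minus_commute)

lemma t_crit_nonneg: "0 \<le> tc"
  by (simp add: t_crit_eq)

lemma slice_support_attained:
  assumes "tc \<le> t"
  obtains \<nu> where "\<nu> \<in> K" "norm (\<nu> - \<mu>) \<le> t" "m t z = z \<bullet> (\<nu> - \<mu>)"
    "\<And>\<nu>'. \<nu>' \<in> K \<Longrightarrow> norm (\<nu>' - \<mu>) \<le> t \<Longrightarrow> z \<bullet> (\<nu>' - \<mu>) \<le> m t z"
proof -
  let ?S = "{\<nu> \<in> K. norm (\<nu> - \<mu>) \<le> t}"
  have S: "?S = K \<inter> cball \<mu> t" by (auto simp: dist_norm norm_minus_commute)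
  have "compact ?S" unfolding S using K(2) by (intro closed_Int_compact) auto
  moreover have "\<nu>\<^sub>0 \<in> ?S" using nu0 assms t_crit_eq by auto
  ultimately obtain \<nu> where \<nu>: "\<nu> \<in> ?S" "\<And>\<nu>'. \<nu>' \<in> ?S \<Longrightarrow> z \<bullet> (\<nu>' - \<mu>) \<le> z \<bullet> (\<nu> - \<mu>)"
    using continuous_attains_sup[of ?S "\<lambda>\<nu>. z \<bullet> (\<nu> - \<mu>)"] by (fastforce intro: continuous_intros)
  then have "m t z = z \<bullet> (\<nu> - \<mu>)"
    unfolding slice_support_def by (intro cSup_eq_maximum) auto
  with \<nu> show ?thesis by (intro that) auto
qed

lemma slice_support_upper:
  "\<nu> \<in> K \<Longrightarrow> norm (\<nu> - \<mu>) \<le> t \<Longrightarrow> z \<bullet> (\<nu> - \<mu>) \<le> m t z"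
  using slice_support_attained[of t z] t_crit_le[of \<nu>] by (meson order_trans)

lemma SUP_ereal_slice:
  assumes "tc \<le> t"
  shows "(SUP \<nu>\<in>{\<nu> \<in> K. norm (\<nu> - \<mu>) \<le> t}. ereal (z \<bullet> (\<nu> - \<mu>))) = ereal (m t z)"
proof (rule antisym)
  show "(SUP \<nu>\<in>{\<nu> \<in> K. norm (\<nu> - \<mu>) \<le> t}. ereal (z \<bullet> (\<nu> - \<mu>))) \<le> ereal (m t z)"
    by (rule SUP_least) (auto intro: slice_support_upper)
  obtain \<nu> where "\<nu> \<in> K" "norm (\<nu> - \<mu>) \<le> t" "m t z = z \<bullet> (\<nu> - \<mu>)"
    using slice_support_attained[OF assms] by metis
  then show "ereal (m t z) \<le> (SUP \<nu>\<in>{\<nu> \<in> K. norm (\<nu> - \<mu>) \<le> t}. ereal (z \<bullet> (\<nu> - \<mu>)))"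
    by (auto intro!: SUP_upper2)
qed

lemma slice_support_lipschitz:
  assumes "tc \<le> t"
  shows "\<bar>m t y - m t z\<bar> \<le> t * norm (y - z)"
proof -
  have "m t y \<le> m t z + t * norm (y - z)" for y z
  proof -
    obtain \<nu> where \<nu>: "\<nu> \<in> K" "norm (\<nu> - \<mu>) \<le> t" "m t y = y \<bullet> (\<nu> - \<mu>)"
      using slice_support_attained[OF assms] by metis
    have "y \<bullet> (\<nu> - \<mu>) = z \<bullet> (\<nu> - \<mu>) + (y - z) \<bullet> (\<nu> - \<mu>)" by (simp add: inner_diff_left)
    also have "(y - z) \<bullet> (\<nu> - \<mu>) \<le> norm (y - z) * norm (\<nu> - \<mu>)" by (rule norm_cauchy_schwarz)
    also have "\<dots> \<le> norm (y - z) * t" using \<nu> by (intro mult_left_mono) auto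
    finally show ?thesis using slice_support_upper[OF \<nu>(1,2), of z] \<nu>(3) by (simp add: mult.commute)
  qed
  from this[of y z] this[of z y] show ?thesis by (simp add: norm_minus_commute abs_le_iff)
qed

lemma abs_slice_support_le:
  assumes "tc \<le> t" shows "\<bar>m t z\<bar> \<le> t * norm z"
proof -
  have "m t 0 = 0" using slice_support_attained[OF assms, of 0] by (metis inner_zero_left)
  then show ?thesis using slice_support_lipschitz[OF assms, of z 0] by simp
qed

lemma slice_support_concave:
  assumes "tc \<le> s" "tc \<le> t" "0 \<le> u" "u \<le> 1"
  shows "(1 - u) * m s z + u * m t z \<le> m ((1 - u) * s + u * t) z"
proof -
  obtain \<nu> where \<nu>: "\<nu> \<in> K" "norm (\<nu> - \<mu>) \<le> s" "m s z = z \<bullet> (\<nu> - \<mu>)"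
    using slice_support_attained[OF assms(1)] by metis
  obtain \<xi> where \<xi>: "\<xi> \<in> K" "norm (\<xi> - \<mu>) \<le> t" "m t z = z \<bullet> (\<xi> - \<mu>)"
    using slice_support_attained[OF assms(2)] by metis
  let ?w = "(1 - u) *\<^sub>R \<nu> + u *\<^sub>R \<xi>"
  have w: "?w - \<mu> = (1 - u) *\<^sub>R (\<nu> - \<mu>) + u *\<^sub>R (\<xi> - \<mu>)" by (simp add: algebra_simps)
  have "?w \<in> K" using K(3) \<nu> \<xi> assms by (intro convexD) auto
  moreover have "norm (?w - \<mu>) \<le> (1 - u) * norm (\<nu> - \<mu>) + u * norm (\<xi> - \<mu>)"
    unfolding w using norm_triangle_ineq[of "(1 - u) *\<^sub>R (\<nu> - \<mu>)" "u *\<^sub>R (\<xi> - \<mu>)"] assms by simp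
  then have "norm (?w - \<mu>) \<le> (1 - u) * s + u * t"
    using mult_left_mono[OF \<nu>(2), of "1 - u"] mult_left_mono[OF \<xi>(2), of u] assms by linarith
  ultimately have "z \<bullet> (?w - \<mu>) \<le> m ((1 - u) * s + u * t) z" by (rule slice_support_upper)
  then show ?thesis unfolding w by (simp add: inner_add_right \<nu> \<xi>)
qed

lemma slice_support_mono: "tc \<le> s \<Longrightarrow> s \<le> t \<Longrightarrow> m s z \<le> m t z"
  using slice_support_attained[of s z] slice_support_upper[of _ t z] by (metis order_trans)

text \<open>
  Let $\nu_0$ be the projection of $\mu$ onto $K$ and let $\nu$ attain $m_t(z)$.  The angle at $\nu_0$
  is obtuse, so $\|\nu - \nu_0\|^2 \le t^2 - t_c^2$.  Moving $\nu$ towards $\nu_0$ by the fraction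
  $(t - s)/(t - t_c)$ brings it into the ball of radius $s$ and changes the inner product with $z$ by at
  most $\|z\| \sqrt{(t - s)(t + t_c)}$.  The bound is uniform up to $s = t_c$, where concavity
  alone would not exclude a jump.
\<close>

lemma slice_support_hoelder:
  assumes "tc \<le> s" "s \<le> t"
  shows "m t z \<le> m s z + norm z * sqrt ((t - s) * (t + tc))"
proof (cases "s = t")
  case False
  then have st: "s < t" "tc < t" using assms by auto
  obtain \<nu> where \<nu>: "\<nu> \<in> K" "norm (\<nu> - \<mu>) \<le> t" "m t z = z \<bullet> (\<nu> - \<mu>)"
    using slice_support_attained[of t z] st by (metis less_imp_le)
  define u where "u = (t - s) / (t - tc)"
  have u: "0 \<le> u" "u \<le> 1" and u_gap: "u * (t - tc) = t - s"
    using st assms by (auto simp: u_def)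
  have "(1 - u) * t + u * tc = t - u * (t - tc)" by (simp add: algebra_simps)
  also have "\<dots> = s" unfolding u_gap by simp
  finally have u_mix: "(1 - u) * t + u * tc = s" .
  let ?w = "(1 - u) *\<^sub>R \<nu> + u *\<^sub>R \<nu>\<^sub>0"
  have w: "?w - \<mu> = (1 - u) *\<^sub>R (\<nu> - \<mu>) + u *\<^sub>R (\<nu>\<^sub>0 - \<mu>)" by (simp add: algebra_simps)
  have "norm (?w - \<mu>) \<le> (1 - u) * norm (\<nu> - \<mu>) + u * tc"
    unfolding w t_crit_eq using norm_triangle_ineq[of "(1 - u) *\<^sub>R (\<nu> - \<mu>)" "u *\<^sub>R (\<nu>\<^sub>0 - \<mu>)"] u by simp
  also have "\<dots> \<le> (1 - u) * t + u * tc" using \<nu> u by (intro add_right_mono mult_left_mono) auto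
  finally have nw: "norm (?w - \<mu>) \<le> s" unfolding u_mix .
  have "?w \<in> K" using K(3) \<nu> nu0 u by (intro convexD) auto
  from slice_support_upper[OF this nw, of z]
  have 1: "z \<bullet> (?w - \<mu>) \<le> m s z" .
  have obt: "(\<mu> - \<nu>\<^sub>0) \<bullet> (\<nu> - \<nu>\<^sub>0) \<le> 0" using closest_point_dot[OF K(3,2) \<nu>(1)] .
  have "(norm (\<nu> - \<mu>))\<^sup>2 = (norm (\<nu> - \<nu>\<^sub>0))\<^sup>2 + tc\<^sup>2 - 2 * ((\<mu> - \<nu>\<^sub>0) \<bullet> (\<nu> - \<nu>\<^sub>0))"
    unfolding t_crit_eq power2_norm_eq_inner by (simp add: inner_diff inner_commute algebra_simps)
  moreover have "(norm (\<nu> - \<mu>))\<^sup>2 \<le> t\<^sup>2" using \<nu> by (intro power_mono) auto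
  ultimately have "(norm (\<nu> - \<nu>\<^sub>0))\<^sup>2 \<le> (t - tc) * (t + tc)"
    using obt by (simp add: power2_eq_square algebra_simps)
  then have "u\<^sup>2 * (norm (\<nu> - \<nu>\<^sub>0))\<^sup>2 \<le> u\<^sup>2 * ((t - tc) * (t + tc))"
    by (rule mult_left_mono) simp
  also have "\<dots> = u * ((u * (t - tc)) * (t + tc))" by (simp add: power2_eq_square)
  also have "\<dots> \<le> 1 * ((t - s) * (t + tc))"
    unfolding u_gap using u st t_crit_nonneg by (intro mult_right_mono) auto
  finally have "u * norm (\<nu> - \<nu>\<^sub>0) \<le> sqrt ((t - s) * (t + tc))"
    by (intro real_le_rsqrt) (simp add: power_mult_distrib)
  then have "norm z * (u * norm (\<nu> - \<nu>\<^sub>0)) \<le> norm z * sqrt ((t - s) * (t + tc))"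
    by (rule mult_left_mono) simp
  moreover have "z \<bullet> (\<nu> - \<mu>) = z \<bullet> (?w - \<mu>) + z \<bullet> (u *\<^sub>R (\<nu> - \<nu>\<^sub>0))"
    by (simp add: inner_diff_right inner_add_right algebra_simps)
  moreover have "z \<bullet> (u *\<^sub>R (\<nu> - \<nu>\<^sub>0)) \<le> norm z * norm (u *\<^sub>R (\<nu> - \<nu>\<^sub>0))" by (rule norm_cauchy_schwarz)
  ultimately show ?thesis using 1 \<nu>(3) u by simp
qed simp

text \<open>
  The projection minimizes $\|z + \mu - \nu\|^2 = \|z\|^2 - 2 z \cdot (\nu - \mu) + \|\nu - \mu\|^2$ over
  $K$, hence maximizes $z \cdot (\nu - \mu) - \|\nu - \mu\|^2/2$.  On the slice of radius $t$ the
  latter is at least $z \cdot (\nu - \mu) - t^2/2$.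
\<close>

lemma closest_point_radius_maximizes:
  fixes z :: "real ^ 'n"
  defines "r \<equiv> norm (closest_point K (z + \<mu>) - \<mu>)"
  assumes t: "tc \<le> t"
  shows "m t z - t\<^sup>2 / 2 \<le> m r z - r\<^sup>2 / 2"
proof -
  let ?p = "closest_point K (z + \<mu>)"
  have p: "?p \<in> K" using K closest_point_in_set by blast
  obtain \<nu> where \<nu>: "\<nu> \<in> K" "norm (\<nu> - \<mu>) \<le> t" "m t z = z \<bullet> (\<nu> - \<mu>)"
    using slice_support_attained[OF t] by metis
  have expand: "(dist (z + \<mu>) y)\<^sup>2 = (norm z)\<^sup>2 - 2 * (z \<bullet> (y - \<mu>)) + (norm (y - \<mu>))\<^sup>2" for y
    unfolding dist_norm power2_norm_eq_inner by (simp add: inner_diff inner_add inner_commute algebra_simps)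
  have "(dist (z + \<mu>) ?p)\<^sup>2 \<le> (dist (z + \<mu>) \<nu>)\<^sup>2"
    using closest_point_le[OF K(2) \<nu>(1)] by (intro power_mono) auto
  then have "z \<bullet> (\<nu> - \<mu>) - (norm (\<nu> - \<mu>))\<^sup>2 / 2 \<le> z \<bullet> (?p - \<mu>) - r\<^sup>2 / 2"
    unfolding expand r_def by (simp add: field_simps)
  moreover have "(norm (\<nu> - \<mu>))\<^sup>2 \<le> t\<^sup>2" using \<nu> by (intro power_mono) auto
  moreover have "z \<bullet> (?p - \<mu>) \<le> m r z" by (rule slice_support_upper[OF p]) (simp add: r_def)
  ultimately show ?thesis using \<nu>(3) by linarith
qed

lemma t_crit_le_closest_point_radius: "tc \<le> norm (closest_point K (z + \<mu>) - \<mu>)"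
  using K closest_point_in_set by (intro t_crit_le) blast

text \<open>
  A concave function increases towards its maximizer, which by the preceding lemma is the radius of
  the projection.
\<close>

lemma penalized_slice_support_between:
  fixes z :: "real ^ 'n"
  defines "\<phi> \<equiv> \<lambda>t. m t z - t\<^sup>2 / 2" and "r \<equiv> norm (closest_point K (z + \<mu>) - \<mu>)"
  assumes t: "tc \<le> t" and s: "s \<in> closed_segment t r"
  shows "\<phi> t \<le> \<phi> s"
proof -
  from s obtain u where u: "0 \<le> u" "u \<le> 1" "s = (1 - u) * t + u * r"
    by (auto simp: in_segment)
  have r: "tc \<le> r" unfolding r_def by (rule t_crit_le_closest_point_radius)
  have "(1 - u) * m t z + u * m r z \<le> m s z"
    unfolding u(3) using slice_support_concave[OF t r u(1,2)] .
  moreover have "s\<^sup>2 / 2 = (1 - u) * (t\<^sup>2 / 2) + u * (r\<^sup>2 / 2) - u * (1 - u) * (t - r)\<^sup>2 / 2"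
    unfolding u(3) by (simp add: power2_eq_square field_simps)
  moreover have "0 \<le> u * (1 - u) * (t - r)\<^sup>2" using u by simp
  ultimately have "(1 - u) * \<phi> t + u * \<phi> r \<le> \<phi> s"
    unfolding \<phi>_def right_diff_distrib by linarith
  moreover have "u * \<phi> t \<le> u * \<phi> r"
    using closest_point_radius_maximizes[OF t] u unfolding \<phi>_def r_def by (intro mult_left_mono) auto
  ultimately show ?thesis by (simp add: algebra_simps)
qed

section \<open>The expected penalized support function\<close>

context
  fixes M :: "'s measure" and Z :: "'s \<Rightarrow> real ^ 'n"
  assumes M: "prob_space M" and Z: "std_gaussian_vector M Z"
begin

interpretation prob_space M by (rule M)

private definition "mean_m t = (\<integral>\<omega>. m t (Z \<omega>) \<partial>M)"
private definition "obj t = mean_m t - t\<^sup>2 / 2"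

private lemma integrable_m: "tc \<le> t \<Longrightarrow> integrable M (\<lambda>\<omega>. m t (Z \<omega>))"
  by (rule integrable_lipschitz_gaussian[OF M Z]) (rule slice_support_lipschitz)

private lemma integrable_norm_Z: "integrable M (\<lambda>\<omega>. norm (Z \<omega>))"
  by (rule integrable_lipschitz_gaussian[OF M Z, where L=1]) (simp add: norm_triangle_ineq3)

lemma lse_fun_below_t_crit:
  assumes "t < tc" shows "lse_fun M Z K \<mu> t = - \<infinity>"
proof -
  have empty: "{\<nu> \<in> K. norm (\<nu> - \<mu>) \<le> t} = {}"
    using assms t_crit_le by fastforce
  have "e2ennreal (-\<infinity>) = 0" "e2ennreal \<infinity> = top"
    by (auto simp: e2ennreal_neg e2ennreal_infty)
  then show ?thesis
    unfolding lse_fun_def ereal_expectation_def empty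
    by (simp add: bot_ereal_def emeasure_space_1 ennreal_top_mult zero_ennreal.rep_eq)
qed

private lemma lse_fun_eq:
  assumes "tc \<le> t" shows "lse_fun M Z K \<mu> t = ereal (obj t)"
  unfolding lse_fun_def SUP_ereal_slice[OF assms] ereal_expectation_integrable[OF integrable_m[OF assms]]
  by (simp add: obj_def mean_m_def)

lemma lse_fun_finite: "tc \<le> t \<Longrightarrow> \<bar>lse_fun M Z K \<mu> t\<bar> \<noteq> \<infinity>"
  by (simp add: lse_fun_eq)

private lemma obj_strongly_concave:
  assumes "tc \<le> s" "tc \<le> t" "0 \<le> u" "u \<le> 1"
  shows "(1 - u) * obj s + u * obj t + u * (1 - u) * (s - t)\<^sup>2 / 2 \<le> obj ((1 - u) * s + u * t)"
proof -
  let ?v = "(1 - u) * s + u * t"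
  have v: "tc \<le> ?v" using convex_bound_le[of "- s" "- tc" "- t" "1 - u" u] assms by simp
  have "(1 - u) * mean_m s + u * mean_m t = (\<integral>\<omega>. (1 - u) * m s (Z \<omega>) + u * m t (Z \<omega>) \<partial>M)"
    unfolding mean_m_def using assms by (subst Bochner_Integration.integral_add) (auto intro: integrable_m)
  also have "\<dots> \<le> mean_m ?v"
    unfolding mean_m_def using assms v
    by (intro integral_mono slice_support_concave) (auto intro!: integrable_m)
  finally have "(1 - u) * mean_m s + u * mean_m t \<le> mean_m ?v" .
  moreover have "?v\<^sup>2 / 2 = (1 - u) * (s\<^sup>2 / 2) + u * (t\<^sup>2 / 2) - u * (1 - u) * (s - t)\<^sup>2 / 2"
    by (simp add: power2_eq_square field_simps)
  ultimately show ?thesis unfolding obj_def right_diff_distrib by linarith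
qed

private lemma obj_continuous: "continuous_on {tc..} obj"
proof -
  define c where "c = (\<integral>\<omega>. norm (Z \<omega>) \<partial>M)"
  have hoelder: "\<bar>mean_m t - mean_m s\<bar> \<le> c * sqrt ((t - s) * (t + tc))" if "tc \<le> s" "s \<le> t" for s t
  proof -
    have t: "tc \<le> t" using that by simp
    have "mean_m s \<le> mean_m t"
      unfolding mean_m_def using that t by (intro integral_mono integrable_m slice_support_mono)
    moreover have "mean_m t \<le> (\<integral>\<omega>. m s (Z \<omega>) + norm (Z \<omega>) * sqrt ((t - s) * (t + tc)) \<partial>M)"
      unfolding mean_m_def using that t
      by (intro integral_mono slice_support_hoelder Bochner_Integration.integrable_add integrable_mult_left
          integrable_m integrable_norm_Z)
    then have "mean_m t \<le> mean_m s + c * sqrt ((t - s) * (t + tc))"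
      unfolding mean_m_def c_def using that integrable_m integrable_norm_Z
      by (subst (asm) Bochner_Integration.integral_add) auto
    ultimately show ?thesis by simp
  qed
  have hoelder': "\<bar>mean_m t - mean_m s\<bar> \<le> c * sqrt (\<bar>t - s\<bar> * (max s t + tc))" if "tc \<le> s" "tc \<le> t" for s t
    using hoelder[of s t] hoelder[of t s] that by (cases "s \<le> t") (auto simp: max_def abs_minus_commute)
  have "continuous_on {tc..} mean_m"
    unfolding continuous_on_def
  proof
    fix s assume s: "s \<in> {tc..}"
    have "((\<lambda>t. c * sqrt (\<bar>t - s\<bar> * (max s t + tc))) \<longlongrightarrow> c * sqrt (\<bar>s - s\<bar> * (max s s + tc))) (at s within {tc..})"
      by (intro tendsto_intros)
    then have "((\<lambda>t. c * sqrt (\<bar>t - s\<bar> * (max s t + tc))) \<longlongrightarrow> 0) (at s within {tc..})" by simp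
    then have "((\<lambda>t. mean_m t - mean_m s) \<longlongrightarrow> 0) (at s within {tc..})"
      by (rule Lim_null_comparison[rotated]) (use hoelder' s in \<open>auto simp: eventually_at_filter\<close>)
    then show "(mean_m \<longlongrightarrow> mean_m s) (at s within {tc..})" by (rule Lim_null[THEN iffD2])
  qed
  then show ?thesis unfolding obj_def[abs_def] by (intro continuous_intros) auto
qed

text \<open>
  Since $m_t(z) \le t \|z\|$, the objective is at most $t c - t^2/2 \le c^2 - t^2/4$ with
  $c = \mathbb{E} \|Z\|$, and $t^2/4 \ge t$ once $t \ge 4$.
\<close>

private lemma obj_eventually_less: "eventually (\<lambda>t. tc \<le> t \<and> obj t < r) at_top"
proof -
  define c where "c = (\<integral>\<omega>. norm (Z \<omega>) \<partial>M)"
  have below: "obj t < r" if t: "tc \<le> t" "4 \<le> t" "c\<^sup>2 - r < t" for t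
  proof -
    have "mean_m t \<le> (\<integral>\<omega>. t * norm (Z \<omega>) \<partial>M)"
      unfolding mean_m_def using abs_slice_support_le[OF t(1)]
      by (intro integral_mono integrable_m t integrable_mult_right integrable_norm_Z) (simp add: abs_le_iff)
    then have "mean_m t \<le> t * c" by (simp add: c_def)
    moreover have "t * c \<le> c\<^sup>2 + t\<^sup>2 / 4"
      using zero_le_power2[of "c - t / 2"] by (simp add: power2_eq_square field_simps)
    moreover have "t * 4 \<le> t\<^sup>2" unfolding power2_eq_square using t by (intro mult_left_mono) auto
    ultimately show ?thesis unfolding obj_def using t by linarith
  qed
  show ?thesis
    using eventually_ge_at_top[of "tc"] eventually_ge_at_top[of "4::real"] eventually_gt_at_top[of "c\<^sup>2 - r"]
    by eventually_elim (use below in simp)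
qed

private lemma obj_max_exists: obtains s where "tc \<le> s" "\<And>t. tc \<le> t \<Longrightarrow> obj t \<le> obj s"
proof -
  obtain T where T: "\<And>t. T \<le> t \<Longrightarrow> tc \<le> t \<and> obj t < obj tc"
    using obj_eventually_less[of "obj tc"] unfolding eventually_at_top_linorder by blast
  have "tc \<le> T" using T by blast
  then obtain s where s: "s \<in> {tc..T}" "\<And>t. t \<in> {tc..T} \<Longrightarrow> obj t \<le> obj s"
    using continuous_attains_sup[of "{tc..T}" obj] continuous_on_subset[OF obj_continuous, of "{tc..T}"]
    by (metis atLeastAtMost_iff atLeast_iff compact_Icc empty_iff order_refl subsetI)
  show ?thesis
  proof (rule that)
    show "tc \<le> s" using s by simp
    show "obj t \<le> obj s" if "tc \<le> t" for t
      using s(2)[of t] s(2)[of tc] T[of t] that \<open>tc \<le> T\<close> by (cases "t \<le> T") force+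
  qed
qed

private lemma obj_gap:
  assumes "tc \<le> s" "\<And>t. tc \<le> t \<Longrightarrow> obj t \<le> obj s" "tc \<le> t"
  shows "obj t + (s - t)\<^sup>2 / 2 \<le> obj s"
proof (rule strongly_concave_max_gap)
  fix u :: real assume u: "0 < u" "u < 1"
  then show "(1 - u) * obj s + u * obj t + u * (1 - u) * (s - t)\<^sup>2 / 2 \<le> obj ((1 - u) * s + u * t)"
    by (intro obj_strongly_concave assms) auto
  show "obj ((1 - u) * s + u * t) \<le> obj s"
    using convex_bound_le[of "- s" "- tc" "- t" "1 - u" u] assms u by (intro assms(2)) simp
qed

text \<open>
  Below the critical radius the value is $-\infty$, so the maximizers over $[0, \infty)$ are those of the
  real-valued objective over $[t_c, \infty)$.
\<close>

private lemma is_arg_max_lse_fun_iff: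
  "is_arg_max (lse_fun M Z K \<mu>) (\<lambda>t. 0 \<le> t) s \<longleftrightarrow> tc \<le> s \<and> (\<forall>t\<ge>tc. obj t \<le> obj s)"
proof
  assume s: "is_arg_max (lse_fun M Z K \<mu>) (\<lambda>t. 0 \<le> t) s"
  have "tc \<le> s"
  proof (rule ccontr)
    assume "\<not> tc \<le> s"
    then have "lse_fun M Z K \<mu> s < lse_fun M Z K \<mu> tc"
      by (simp add: lse_fun_below_t_crit lse_fun_eq)
    then show False using s t_crit_nonneg by (auto simp: is_arg_max_def)
  qed
  moreover have "obj t \<le> obj s" if "tc \<le> t" for t
    using s that \<open>tc \<le> s\<close> t_crit_nonneg lse_fun_eq
    unfolding is_arg_max_def by (metis ereal_less_eq(3) not_less order_trans)
  ultimately show "tc \<le> s \<and> (\<forall>t\<ge>tc. obj t \<le> obj s)" by simp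
next
  assume s: "tc \<le> s \<and> (\<forall>t\<ge>tc. obj t \<le> obj s)"
  have "lse_fun M Z K \<mu> t \<le> lse_fun M Z K \<mu> s" for t
    using s by (cases "tc \<le> t") (auto simp: lse_fun_below_t_crit lse_fun_eq)
  then show "is_arg_max (lse_fun M Z K \<mu>) (\<lambda>t. 0 \<le> t) s"
    using s t_crit_nonneg by (auto simp: is_arg_max_def not_less)
qed

lemma ex1_arg_max_lse_fun: "\<exists>!t. is_arg_max (lse_fun M Z K \<mu>) (\<lambda>t. 0 \<le> t) t"
proof -
  obtain s where s: "tc \<le> s" "\<And>t. tc \<le> t \<Longrightarrow> obj t \<le> obj s" using obj_max_exists by blast
  show ?thesis
    unfolding is_arg_max_lse_fun_iff
  proof (rule ex1I)
    show "tc \<le> s \<and> (\<forall>t\<ge>tc. obj t \<le> obj s)" using s by simp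
    fix t assume t: "tc \<le> t \<and> (\<forall>v\<ge>tc. obj v \<le> obj t)"
    then have "(s - t)\<^sup>2 \<le> 0" using obj_gap[OF s, of t] s(1) by (smt (verit) field_sum_of_halves)
    then show "t = s" by simp
  qed
qed

private lemma t_max_properties:
  defines "T \<equiv> t_max M Z K \<mu>"
  shows "tc \<le> T" "\<And>t. tc \<le> t \<Longrightarrow> obj t \<le> obj T"
proof -
  have "is_arg_max (lse_fun M Z K \<mu>) (\<lambda>t. 0 \<le> t) T"
    unfolding T_def t_max_def arg_max_def by (rule someI_ex[OF ex1_implies_ex[OF ex1_arg_max_lse_fun]])
  then show "tc \<le> T" "\<And>t. tc \<le> t \<Longrightarrow> obj t \<le> obj T"
    by (auto simp: is_arg_max_lse_fun_iff)
qed

text \<open>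
  Here and in the next lemma \<open>L\<close> may exceed the Lipschitz constant \<open>t\<close>: a single value then serves
  all three radii of the final argument, including the radius $0$, for which $m_0 = 0$.
\<close>

private lemma m_upper_tail:
  assumes t: "tc \<le> t" "t \<le> L" "0 < L" and d: "0 \<le> d"
  shows "prob {\<omega> \<in> space M. m t (Z \<omega>) \<ge> mean_m t + d} \<le> exp (- d\<^sup>2 / (2 * L\<^sup>2))"
  unfolding mean_m_def
proof (rule gaussian_lipschitz_concentration[OF M Z _ t(3) d])
  fix x y :: "real ^ 'n"
  have "t * norm (x - y) \<le> L * norm (x - y)" using t by (intro mult_right_mono) auto
  then show "\<bar>m t x - m t y\<bar> \<le> L * norm (x - y)"
    using slice_support_lipschitz[OF t(1), of x y] by linarith
qed

private lemma m_lower_tail: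
  assumes t: "tc \<le> t" "t \<le> L" "0 < L" and d: "0 \<le> d"
  shows "prob {\<omega> \<in> space M. m t (Z \<omega>) \<le> mean_m t - d} \<le> exp (- d\<^sup>2 / (2 * L\<^sup>2))"
proof -
  have "prob {\<omega> \<in> space M. - m t (Z \<omega>) \<ge> (\<integral>\<omega>. - m t (Z \<omega>) \<partial>M) + d} \<le> exp (- d\<^sup>2 / (2 * L\<^sup>2))"
  proof (rule gaussian_lipschitz_concentration[OF M Z _ t(3) d])
    fix x y :: "real ^ 'n"
    have "t * norm (x - y) \<le> L * norm (x - y)" using t by (intro mult_right_mono) auto
    then show "\<bar>- m t x - - m t y\<bar> \<le> L * norm (x - y)"
      using slice_support_lipschitz[OF t(1), of x y] by linarith
  qed
  moreover have "- m t (Z \<omega>) \<ge> (\<integral>\<omega>. - m t (Z \<omega>) \<partial>M) + d \<longleftrightarrow> m t (Z \<omega>) \<le> mean_m t - d" for \<omega>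
    by (auto simp: mean_m_def)
  ultimately show ?thesis by simp
qed

private lemma measurable_m_Z: 
  assumes "tc \<le> t" shows "(\<lambda>\<omega>. m t (Z \<omega>)) \<in> borel_measurable M"
  using integrable_m[OF assms] by simp

text \<open>
  Let $L$ and $l$ be the two radii $T \pm x \sqrt T$.  At both, the mean of the penalized support
  function is smaller than at $T$ by at least $2d$, where $d = x^2 T/4$.  If $r$ lies beyond one of
  them, the random function is nevertheless at least as large there as at $T$; so it is above its
  mean by $d$ there or below its mean by $d$ at $T$.  Each of the three deviations has
  probability at most $\exp (-d^2/(2 L^2))$, and $L = T (1 + x/\sqrt T)$.
\<close>

lemma lse_radius_tail_bound:
  assumes x: "0 \<le> x"
  defines "T \<equiv> t_max M Z K \<mu>"
  shows "measure M {\<omega> \<in> space M. \<bar>norm (closest_point K (Z \<omega> + \<mu>) - \<mu>) - T\<bar> \<ge> x * sqrt T}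
      \<le> 3 * exp (- tail_exponent x T)"
proof (cases "T = 0 \<or> x = 0")
  case True
  then have "tail_exponent x T = 0" by (auto simp: tail_exponent_def)
  then show ?thesis using prob_le_1 by (simp add: order_trans[OF prob_le_1])
next
  case False
  note T = t_max_properties[folded T_def]
  have T0: "0 < T" and x0: "0 < x" using False T(1) t_crit_nonneg x by auto
  define L where "L = T + x * sqrt T"
  define l where "l = T - x * sqrt T"
  define d where "d = x\<^sup>2 * T / 4"
  have xT: "0 < x * sqrt T" using x0 T0 by simp
  have L: "tc \<le> L" "0 < L" "T \<le> L" "l \<le> L" using T(1) T0 xT by (auto simp: L_def l_def)
  have d: "0 \<le> d" using T0 by (simp add: d_def)
  have gap: "obj t + 2 * d \<le> obj T" if "tc \<le> t" "t = L \<or> t = l" for t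
  proof -
    have "(T - t)\<^sup>2 = x\<^sup>2 * T" using that(2) T0 by (auto simp: L_def l_def power_mult_distrib)
    then show ?thesis using obj_gap[OF T that(1)] unfolding d_def by linarith
  qed
  define r where "r = (\<lambda>\<omega>. norm (closest_point K (Z \<omega> + \<mu>) - \<mu>))"
  define A where "A = {\<omega> \<in> space M. m T (Z \<omega>) \<le> mean_m T - d}"
  \<comment> \<open>The condition \<open>tc \<le> t\<close> makes the event empty when \<open>l\<close> lies below the critical radius; no projection has such a radius.\<close>
  define B where "B = (\<lambda>t. {\<omega> \<in> space M. tc \<le> t \<and> m t (Z \<omega>) \<ge> mean_m t + d})"
  define e where "e = exp (- d\<^sup>2 / (2 * L\<^sup>2))"
  have A: "A \<in> events" "prob A \<le> e"
    unfolding A_def e_def using m_lower_tail[OF T(1) L(3,2) d] measurable_m_Z[OF T(1)] by simp_all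
  have B: "B t \<in> events" "prob (B t) \<le> e" if "t \<le> L" for t
    using m_upper_tail[OF _ that L(2) d] measurable_m_Z[of t]
    by (cases "tc \<le> t"; simp add: B_def e_def)+
  have caught: "\<omega> \<in> A \<union> B t"
    if \<omega>: "\<omega> \<in> space M" and t: "t = L \<or> t = l" "t \<in> closed_segment T (r \<omega>)" for \<omega> t
  proof -
    have "tc \<le> r \<omega>" unfolding r_def by (rule t_crit_le_closest_point_radius)
    then have tc: "tc \<le> t"
      using t(2) T(1) by (auto simp: closed_segment_eq_real_ivl split: if_splits)
    have "m T (Z \<omega>) - T\<^sup>2 / 2 \<le> m t (Z \<omega>) - t\<^sup>2 / 2"
      using penalized_slice_support_between[OF T(1) t(2)[unfolded r_def]] .
    then show ?thesis
      using gap[OF tc t(1)] tc \<omega> unfolding A_def B_def obj_def by auto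
  qed
  have "{\<omega> \<in> space M. \<bar>r \<omega> - T\<bar> \<ge> x * sqrt T} \<subseteq> A \<union> B L \<union> B l"
  proof
    fix \<omega> assume "\<omega> \<in> {\<omega> \<in> space M. \<bar>r \<omega> - T\<bar> \<ge> x * sqrt T}"
    then have \<omega>: "\<omega> \<in> space M" and "L \<le> r \<omega> \<or> r \<omega> \<le> l" by (auto simp: L_def l_def)
    then have "L \<in> closed_segment T (r \<omega>) \<or> l \<in> closed_segment T (r \<omega>)"
      using xT by (auto simp: closed_segment_eq_real_ivl L_def l_def)
    then show "\<omega> \<in> A \<union> B L \<union> B l" using caught[OF \<omega>] by blast
  qed
  then have "prob {\<omega> \<in> space M. \<bar>r \<omega> - T\<bar> \<ge> x * sqrt T} \<le> prob (A \<union> B L \<union> B l)"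
    using A B L by (intro finite_measure_mono) auto
  also have "\<dots> \<le> prob A + prob (B L) + prob (B l)"
    using measure_Un_le[of "A \<union> B L" M "B l"] measure_Un_le[of A M "B L"] A B L by force
  also have "\<dots> \<le> 3 * e" using A(2) B(2)[of L] B(2)[of l] L by simp
  also have "e = exp (- tail_exponent x T)"
  proof -
    have "L = T * (1 + x / sqrt T)"
      using T0 by (simp add: L_def field_simps)
    then have "d\<^sup>2 / (2 * L\<^sup>2) = x ^ 4 / (32 * (1 + x / sqrt T)\<^sup>2)"
      using T0 by (simp add: d_def power2_eq_square power4_eq_xxxx)
    then show ?thesis using T0 by (simp add: e_def tail_exponent_def)
  qed
  finally show ?thesis by (simp add: r_def)
qed

lemma strictly_concave_lse_fun:
  "strictly_concave_on {tc..} (\<lambda>t. real_of_ereal (lse_fun M Z K \<mu> t))"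
  unfolding strictly_concave_on_def
proof (intro conjI ballI allI impI)
  fix s t u :: real
  assume st: "s \<in> {tc..}" "t \<in> {tc..}" and u: "s \<noteq> t \<and> 0 < u \<and> u < 1"
  let ?v = "(1 - u) * s + u * t"
  have v: "tc \<le> ?v" using convex_bound_le[of "- s" "- tc" "- t" "1 - u" u] st u by simp
  have "0 < u * (1 - u) * (s - t)\<^sup>2" using u by simp
  then have "(1 - u) * obj s + u * obj t < obj ?v"
    using obj_strongly_concave[of s t u] st u unfolding atLeast_iff by linarith
  then show "(1 - u) * real_of_ereal (lse_fun M Z K \<mu> s) + u * real_of_ereal (lse_fun M Z K \<mu> t)
      < real_of_ereal (lse_fun M Z K \<mu> ?v)"
    using st v by (simp add: lse_fun_eq)
qed simp

lemma lse_fun_tendsto_minus_infinity: "(lse_fun M Z K \<mu> \<longlongrightarrow> - \<infinity>) at_top"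
  unfolding tendsto_MInfty
proof
  fix r
  show "eventually (\<lambda>t. lse_fun M Z K \<mu> t < ereal r) at_top"
    using obj_eventually_less[of r] by eventually_elim (simp add: lse_fun_eq)
qed

end

end

section \<open>Least squares under a convex constraint\<close>

theorem theorem1p1:
  fixes K :: "(real ^ 'n) set" and \<mu> :: "real ^ 'n"
    and M :: "'s measure" and Z :: "'s \<Rightarrow> real ^ 'n"
  assumes "K \<noteq> {}" and "closed K" and "convex K"
    and "prob_space M" and "std_gaussian_vector M Z"
  shows
    "(\<forall>t. 0 \<le> t \<and> t < t_crit K \<mu> \<longrightarrow> lse_fun M Z K \<mu> t = - \<infinity>) \<and>
     (\<forall>t\<ge>t_crit K \<mu>. \<bar>lse_fun M Z K \<mu> t\<bar> \<noteq> \<infinity>) \<and>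
     strictly_concave_on {t_crit K \<mu>..} (\<lambda>t. real_of_ereal (lse_fun M Z K \<mu> t)) \<and>
     (lse_fun M Z K \<mu> \<longlongrightarrow> - \<infinity>) at_top \<and>
     (\<exists>!t. is_arg_max (lse_fun M Z K \<mu>) (\<lambda>t. 0 \<le> t) t) \<and>
     (\<forall>x\<ge>0. measure M {\<omega> \<in> space M.
          \<bar>norm (closest_point K (Z \<omega> + \<mu>) - \<mu>) - t_max M Z K \<mu>\<bar> \<ge> x * sqrt (t_max M Z K \<mu>)}
        \<le> 3 * exp (- tail_exponent x (t_max M Z K \<mu>)))"
proof (intro conjI allI impI)
  show "lse_fun M Z K \<mu> t = - \<infinity>" if "0 \<le> t \<and> t < t_crit K \<mu>" for t
    using lse_fun_below_t_crit[OF assms] that by blast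
  show "\<bar>lse_fun M Z K \<mu> t\<bar> \<noteq> \<infinity>" if "t_crit K \<mu> \<le> t" for t
    using lse_fun_finite[OF assms that] .
  show "strictly_concave_on {t_crit K \<mu>..} (\<lambda>t. real_of_ereal (lse_fun M Z K \<mu> t))"
    using strictly_concave_lse_fun[OF assms] .
  show "(lse_fun M Z K \<mu> \<longlongrightarrow> - \<infinity>) at_top"
    using lse_fun_tendsto_minus_infinity[OF assms] .
  show "\<exists>!t. is_arg_max (lse_fun M Z K \<mu>) (\<lambda>t. 0 \<le> t) t"
    using ex1_arg_max_lse_fun[OF assms] .
  show "measure M {\<omega> \<in> space M.
          \<bar>norm (closest_point K (Z \<omega> + \<mu>) - \<mu>) - t_max M Z K \<mu>\<bar> \<ge> x * sqrt (t_max M Z K \<mu>)}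
        \<le> 3 * exp (- tail_exponent x (t_max M Z K \<mu>))" if "0 \<le> x" for x
    using lse_radius_tail_bound[OF assms that] .
qed

end
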